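(* Let $\alpha,\beta\ge0$, let $N$ be a positive integer, and let $X$ be a compact subset of a Banach space $B$ such that $X-X$ is $(\alpha,\beta)$-almost homogeneous with $d_{\rm A}^{\alpha,\beta}(X-X)<s<N$. If $$\gamma>\frac{1+N(2+\alpha+\beta)+(\alpha+\beta)}{N-s},$$ then there is a prevalent set $S$ of linear maps $f:B\to\mathbb R^N$ such that every $f\in S$ is injective on $X$ and, in particular, $\gamma$-almost bi-Lipschitz on $X$.
   Context: For $x>0$, $\operatorname{slog}(x):=\log(x+x^{-1})$. For a metric space $(Y,d)$ and $0<\rho<r$, $\mathcal N_Y(r,\rho)$ denotes the minimum number of balls of radius $\rho$ sufficient to cover any ball of radius $r$ in $Y$. For $\alpha,\beta\ge0$, $M\ge1$, $s\ge0$, $Y$ is $(\alpha,\beta)$-almost $(M,s)$-homogeneous if $\mathcal N_Y(r,\rho)\le M\left(\frac r\rho\right)^s\operatorname{slog}(r)^\beta\operatorname{slog}(\rho)^\alpha$ for all $0<\rho<r<\infty$; it is $(\alpha,\beta)$-almost homogeneous if this holds for some $M,s$. The Assouad $(\alpha,\beta)$-dimension $d_{\rm A}^{\alpha,\beta}(Y)$ is the infimum of all $s$ such that $Y$ is $(\alpha,\beta)$-almost $(M,s)$-homogeneous for some $M\ge1$ ($+\infty$ if there is none). For $X\subset B$, $X-X=\{x-y: x,y\in X\}$ with the metric induced by the norm. A map $f$ is $\gamma$-almost bi-Lipschitz on $X$ if there is $L>0$ with $\frac1L\frac{\|x-y\|}{\operatorname{slog}(\|x-y\|)^\gamma}\le|f(x)-f(y)|\le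 L\|x-y\|$ for all $x,y\in X$, $x\ne y$. A Borel subset $S$ of a normed linear space $V$ is prevalent if there exists a compactly supported probability measure $\mu$ on $V$ such that $\mu(S+v)=1$ for all $v\in V$. Here $V$ is the space of bounded linear maps $B\to\mathbb R^N$ with the operator norm; Banach spaces are real. *)

theory Defs
  imports "HOL-Probability.Probability"
begin

definition slog :: "real \<Rightarrow> real" where
  "slog x = ln (x + inverse x)"

text \<open>
  The metric space in question is the subset \<open>Y\<close> with the induced metric, so the balls are
  relative open balls \<open>Y \<inter> ball c r\<close> with centres \<open>c\<close> in \<open>Y\<close>. Using closed balls instead would
  only change the constant \<open>M\<close> below. If no finite number of balls suffices, the
  infimum is taken over the empty set and equals \<open>\<infinity>\<close>.
\<close>

definition covering_number :: "'a::metric_space set \<Rightarrow> real \<Rightarrow> real \<Rightarrow> enat" where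
  "covering_number Y r \<rho> =
     Inf {enat n | n. \<forall>x\<in>Y. \<exists>C\<subseteq>Y. finite C \<and> card C \<le> n \<and>
       Y \<inter> ball x r \<subseteq> (\<Union>c\<in>C. Y \<inter> ball c \<rho>)}"

definition almost_homogeneous_with ::
    "real \<Rightarrow> real \<Rightarrow> real \<Rightarrow> real \<Rightarrow> 'a::metric_space set \<Rightarrow> bool" where
  "almost_homogeneous_with \<alpha> \<beta> M s Y \<longleftrightarrow>
     (\<forall>r \<rho>. 0 < \<rho> \<and> \<rho> < r \<longrightarrow>
        ereal_of_enat (covering_number Y r \<rho>) \<le>
          ereal (M * (r / \<rho>) powr s * slog r powr \<beta> * slog \<rho> powr \<alpha>))"

definition almost_homogeneous :: "real \<Rightarrow> real \<Rightarrow> 'a::metric_space set \<Rightarrow> bool" where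
  "almost_homogeneous \<alpha> \<beta> Y \<longleftrightarrow> (\<exists>M\<ge>1. \<exists>s\<ge>0. almost_homogeneous_with \<alpha> \<beta> M s Y)"

definition assouad_dim :: "real \<Rightarrow> real \<Rightarrow> 'a::metric_space set \<Rightarrow> ereal" where
  "assouad_dim \<alpha> \<beta> Y =
     Inf {ereal s | s. 0 \<le> s \<and> (\<exists>M\<ge>1. almost_homogeneous_with \<alpha> \<beta> M s Y)}"

definition difference_set :: "'a::real_normed_vector set \<Rightarrow> 'a set" where
  "difference_set X = {x - y | x y. x \<in> X \<and> y \<in> X}"

definition almost_bi_lipschitz_on ::
    "real \<Rightarrow> 'a::real_normed_vector set \<Rightarrow> ('a \<Rightarrow> 'b::real_normed_vector) \<Rightarrow> bool" where
  "almost_bi_lipschitz_on \<gamma> X f \<longleftrightarrow>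
     (\<exists>L>0. \<forall>x\<in>X. \<forall>y\<in>X. x \<noteq> y \<longrightarrow>
        1 / L * (norm (x - y) / slog (norm (x - y)) powr \<gamma>) \<le> norm (f x - f y) \<and>
        norm (f x - f y) \<le> L * norm (x - y))"

text \<open>
  ``Compactly supported'' means that some compact set carries the full measure. This avoids
  the topological support, which is badly behaved on non-separable spaces.
\<close>

definition prevalent :: "'v::real_normed_vector set \<Rightarrow> bool" where
  "prevalent S \<longleftrightarrow> S \<in> sets borel \<and>
     (\<exists>\<mu>::'v measure. prob_space \<mu> \<and> sets \<mu> = sets borel \<and>
        (\<exists>K. compact K \<and> emeasure \<mu> K = 1) \<and>
        (\<forall>v. emeasure \<mu> ((\<lambda>x. x + v) ` S) = 1))"

end

theory Submission
  imports Defs "HOL-Real_Asymp.Real_Asymp"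
begin

text \<open>
  Let \<open>Y = X - X\<close> and let \<open>N\<close> be the dimension of the target. By linearity, a bounded linear
  map \<open>f\<close> is injective and \<open>\<gamma>\<close>-almost bi-Lipschitz on \<open>X\<close> as soon as \<open>norm (f z)\<close> is at least
  a constant times \<open>norm z / slog (norm z) powr \<gamma>\<close> for all nonzero \<open>z\<close> in \<open>Y\<close>. Let \<open>D\<close> bound
  the norms on \<open>Y\<close>. On the dyadic shell of \<open>Y\<close> at scale \<open>d = D / 2 ^ j\<close>, where
  \<open>d / 2 < norm z \<le> d\<close>, this follows from \<open>norm (f z) \<ge> \<rho>\<close>, where \<open>\<rho>\<close> is
  \<open>d * (j + 1) powr (- \<gamma>)\<close> divided by a constant \<open>q\<close>.

  The probe is the law of a random operator built from functionals chosen such that every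
  nonzero point of \<open>Y\<close> is detected by one of them. Almost homogeneity covers \<open>Y\<close> near scale
  \<open>d\<close> by about \<open>(j + 1) powr (\<alpha> + \<beta>)\<close> balls of radius \<open>d / 16\<close>; the Hahn-Banach theorem
  (\<open>ex_norming_functional\<close>) provides a norming functional for each centre, and for every point
  of the shell one of these functionals is at least \<open>d / 8\<close> (\<open>ex_shell_norming_functionals\<close>).
  The random operator is the weighted sum of all these functionals, each multiplied by its own
  random vector, uniform in the unit ball of the target. Conditionally on the other
  coefficients the value at a point \<open>z\<close> is an affine function of one uniform vector with slope
  at least about \<open>d / (j + 1) powr (2 + \<alpha> + \<beta>)\<close>, so any translate of the random operator is
  smaller than \<open>\<rho>\<close> at \<open>z\<close> with probability at most about
  \<open>(\<rho> * (j + 1) powr (2 + \<alpha> + \<beta>) / d) ^ N\<close> (\<open>small_ball_estimate\<close>).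

  All realisations of one translate of the random operator have a common norm bound. Hence, up
  to a constant factor in \<open>\<rho>\<close>, it suffices to test smallness on the shell at the centres of a
  cover by balls of radius \<open>\<rho>\<close>, of which almost homogeneity needs about \<open>(d / \<rho>) powr s\<close> times
  \<open>(j + 1) powr (\<alpha> + \<beta>)\<close>, up to a power of \<open>1 + ln q\<close>. The union bound over the centres gives
  for the shell a failure probability of about
  \<open>q powr (s - N) * (j + 1) powr (\<alpha> + \<beta> + N * (2 + \<alpha> + \<beta>) - \<gamma> * (N - s))\<close>, again up to a power
  of \<open>1 + ln q\<close>. The hypothesis on \<open>\<gamma>\<close> says that this is summable over \<open>j\<close>, and since \<open>s < N\<close>
  the sum tends to 0 as \<open>q\<close> tends to infinity (\<open>not_expanding_estimate\<close>). So almost surely the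
  lower bound holds with some \<open>q\<close>.
\<close>

section \<open>Norming functionals\<close>

definition sublinear :: "('a::real_vector \<Rightarrow> real) \<Rightarrow> bool" where
  "sublinear q \<longleftrightarrow> (\<forall>x y. q (x + y) \<le> q x + q y) \<and> (\<forall>t\<ge>0. \<forall>x. q (t *\<^sub>R x) \<le> t * q x)"

lemma sublinear_add: "sublinear q \<Longrightarrow> q (x + y) \<le> q x + q y"
  by (simp add: sublinear_def)

lemma sublinear_0: "sublinear q \<Longrightarrow> q 0 = 0"
proof -
  assume q: "sublinear q"
  have "q 0 \<le> 0" using q unfolding sublinear_def by (metis mult_zero_left order_refl scale_zero_left)
  moreover have "q 0 \<le> q 0 + q 0" using sublinear_add[OF q, of 0 0] by simp
  ultimately show ?thesis by simp
qed

lemma sublinear_scale: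
  assumes q: "sublinear q" and t: "t \<ge> 0"
  shows "q (t *\<^sub>R x) = t * q x"
proof (cases "t = 0")
  case False
  then have "t > 0" using t by simp
  have "q ((1/t) *\<^sub>R (t *\<^sub>R x)) \<le> (1/t) * q (t *\<^sub>R x)"
    using q \<open>t > 0\<close> unfolding sublinear_def by (metis less_imp_le zero_less_divide_1_iff)
  then have "t * q x \<le> q (t *\<^sub>R x)"
    using \<open>t > 0\<close> by (simp add: field_simps)
  moreover have "q (t *\<^sub>R x) \<le> t * q x" using q t by (simp add: sublinear_def)
  ultimately show ?thesis by simp
qed (use sublinear_0[OF q] in simp)

lemma sublinear_ge_neg: "sublinear q \<Longrightarrow> - q (- x) \<le> q x"
  using sublinear_add[of q x "- x"] sublinear_0[of q] by simp

lemma sublinear_norm: "sublinear norm"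
  by (simp add: sublinear_def norm_triangle_ineq)

text \<open>
  The largest sublinear functional below \<open>q\<close> whose value at \<open>- y\<close> is at most \<open>- q y\<close>. It is
  used twice: a minimal \<open>q\<close> equals all of its tilts, which makes it odd, and tilting the norm
  at \<open>z\<close> before passing to a minimal functional forces the value \<open>norm z\<close> at \<open>z\<close>.
\<close>

definition tilt :: "('a::real_vector \<Rightarrow> real) \<Rightarrow> 'a \<Rightarrow> 'a \<Rightarrow> real" where
  "tilt q y x = (INF t\<in>{0..}. q (x + t *\<^sub>R y) - t * q y)"

lemma tilt_bdd:
  assumes q: "sublinear q"
  shows "bdd_below ((\<lambda>t. q (x + t *\<^sub>R y) - t * q y) ` {0..})"
proof (rule bdd_belowI2)
  fix t :: real assume "t \<in> {0..}"
  then have "t * q y = q (t *\<^sub>R y)" by (simp add: sublinear_scale[OF q])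
  also have "\<dots> \<le> q (x + t *\<^sub>R y) + q (- x)"
    using sublinear_add[OF q, of "x + t *\<^sub>R y" "- x"] by simp
  finally show "- q (- x) \<le> q (x + t *\<^sub>R y) - t * q y" by simp
qed

lemma tilt_le:
  assumes "sublinear q" "t \<ge> 0"
  shows "tilt q y x \<le> q (x + t *\<^sub>R y) - t * q y"
  unfolding tilt_def using assms by (intro cINF_lower tilt_bdd) auto

lemma tilt_greatest:
  assumes "\<And>t. t \<ge> 0 \<Longrightarrow> c \<le> q (x + t *\<^sub>R y) - t * q y"
  shows "c \<le> tilt q y x"
  unfolding tilt_def using assms by (intro cINF_greatest) auto

lemma sublinear_tilt:
  assumes q: "sublinear q"
  shows "sublinear (tilt q y)"
  unfolding sublinear_def
proof (intro conjI allI impI)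
  fix x x'
  have 1: "tilt q y (x + x') \<le> (q (x + t *\<^sub>R y) - t * q y) + (q (x' + u *\<^sub>R y) - u * q y)"
    if "t \<ge> 0" "u \<ge> 0" for t u
  proof -
    have "tilt q y (x + x') \<le> q (x + x' + (t + u) *\<^sub>R y) - (t + u) * q y"
      using that by (intro tilt_le q) simp
    moreover have "q (x + x' + (t + u) *\<^sub>R y) \<le> q (x + t *\<^sub>R y) + q (x' + u *\<^sub>R y)"
      using sublinear_add[OF q, of "x + t *\<^sub>R y" "x' + u *\<^sub>R y"] by (simp add: algebra_simps)
    ultimately show ?thesis by (simp add: algebra_simps)
  qed
  have "tilt q y (x + x') - (q (x + t *\<^sub>R y) - t * q y) \<le> tilt q y x'" if "t \<ge> 0" for t
    using 1[OF that] by (intro tilt_greatest) (simp add: algebra_simps)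
  then have "tilt q y (x + x') - tilt q y x' \<le> tilt q y x"
    by (intro tilt_greatest) (simp add: algebra_simps)
  then show "tilt q y (x + x') \<le> tilt q y x + tilt q y x'" by simp
next
  fix c :: real and x assume "c \<ge> 0"
  show "tilt q y (c *\<^sub>R x) \<le> c * tilt q y x"
  proof (cases "c = 0")
    case True
    then show ?thesis using tilt_le[OF q, of 0 y 0] sublinear_0[OF q] by simp
  next
    case False
    then have "c > 0" using \<open>c \<ge> 0\<close> by simp
    have "tilt q y (c *\<^sub>R x) / c \<le> q (x + t *\<^sub>R y) - t * q y" if "t \<ge> 0" for t
    proof -
      have "tilt q y (c *\<^sub>R x) \<le> q (c *\<^sub>R x + (c * t) *\<^sub>R y) - (c * t) * q y"
        using that \<open>c > 0\<close> by (intro tilt_le q) simp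
      also have "c *\<^sub>R x + (c * t) *\<^sub>R y = c *\<^sub>R (x + t *\<^sub>R y)" by (simp add: algebra_simps)
      finally have "tilt q y (c *\<^sub>R x) \<le> c * (q (x + t *\<^sub>R y) - t * q y)"
        using sublinear_scale[OF q \<open>c \<ge> 0\<close>, of "x + t *\<^sub>R y"]
        by (simp add: right_diff_distrib mult.assoc)
      then show ?thesis using \<open>c > 0\<close> by (simp add: pos_divide_le_eq mult.commute)
    qed
    then have "tilt q y (c *\<^sub>R x) / c \<le> tilt q y x" by (rule tilt_greatest)
    then show ?thesis using \<open>c > 0\<close> by (simp add: pos_divide_le_eq mult.commute)
  qed
qed

lemma tilt_le_self: "sublinear q \<Longrightarrow> tilt q y x \<le> q x"
  using tilt_le[of q 0 y x] by simp

lemma tilt_neg: "sublinear q \<Longrightarrow> tilt q y (- y) \<le> - q y"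
  using tilt_le[of q 1 y "- y"] sublinear_0[of q] by simp

text \<open>
  Minimality gives \<open>tilt q y = q\<close>, hence \<open>q (- y) \<le> - q y\<close>. An odd sublinear functional
  satisfies the reverse of every sublinear inequality as well, so it is linear.
\<close>

lemma linear_if_minimal_sublinear:
  assumes q: "sublinear q"
    and min: "\<And>p. sublinear p \<Longrightarrow> (\<And>x. p x \<le> q x) \<Longrightarrow> p = q"
  shows "linear q"
proof (rule linearI)
  have neg: "q (- y) = - q y" for y
  proof -
    have "tilt q y = q" by (intro min sublinear_tilt tilt_le_self q)
    then show ?thesis using tilt_neg[OF q, of y] sublinear_ge_neg[OF q, of y] by simp
  qed
  show "q (x + y) = q x + q y" for x y
    using sublinear_add[OF q, of x y] sublinear_add[OF q, of "- x" "- y"] neg[of "x + y"] neg[of x] neg[of y]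
    by simp
  show "q (c *\<^sub>R x) = c *\<^sub>R q x" for c x
  proof (cases "c \<ge> 0")
    case False
    then have "q ((- c) *\<^sub>R x) = (- c) * q x" by (intro sublinear_scale q) simp
    then show ?thesis using neg[of "c *\<^sub>R x"] by simp
  qed (simp add: sublinear_scale[OF q])
qed

text \<open>
  Zorn's lemma for the reversed pointwise order. The pointwise infimum of a chain is finite
  because every member is bounded below by \<open>\<lambda>x. - p (- x)\<close>, and it is subadditive because any
  two members of the chain lie above a common one.
\<close>

lemma ex_minimal_sublinear:
  fixes p :: "'a::real_vector \<Rightarrow> real"
  assumes p: "sublinear p"
  obtains q where "sublinear q" "\<And>x. q x \<le> p x"
    "\<And>q'. sublinear q' \<Longrightarrow> (\<And>x. q' x \<le> q x) \<Longrightarrow> q' = q"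
proof -
  define A where "A = {q. sublinear q \<and> q \<le> p}"
  have "\<exists>m\<in>A. \<forall>a\<in>A. m \<ge> a \<longrightarrow> a = m"
  proof (rule predicate_Zorn)
    show "partial_order_on A (relation_of (\<ge>) A)"
      by (rule partial_order_on_relation_ofI) auto
    fix C assume C: "C \<in> Chains (relation_of (\<ge>) A)"
    then have CA: "C \<subseteq> A" by (rule Chains_relation_of)
    have tot: "a \<le> b \<or> b \<le> a" if "a \<in> C" "b \<in> C" for a b
      using C that by (auto simp: Chains_def relation_of_def)
    show "\<exists>u\<in>A. \<forall>a\<in>C. a \<ge> u"
    proof (cases "C = {}")
      case True
      then show ?thesis using p by (auto simp: A_def)
    next
      case False
      define u where "u x = (INF a\<in>C. a x)" for x
      have bdd: "bdd_below ((\<lambda>a. a x) ` C)" for x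
      proof (rule bdd_belowI2)
        fix a assume "a \<in> C"
        then have a: "sublinear a" "a \<le> p" using CA by (auto simp: A_def)
        show "- p (- x) \<le> a x"
          using sublinear_ge_neg[OF a(1), of x] le_funD[OF a(2), of "- x"] by simp
      qed
      have low: "u x \<le> a x" if "a \<in> C" for a x
        unfolding u_def using that by (intro cINF_lower bdd)
      have gre: "c \<le> u x" if "\<And>a. a \<in> C \<Longrightarrow> c \<le> a x" for c x
        unfolding u_def using that False by (intro cINF_greatest)
      have "sublinear u"
        unfolding sublinear_def
      proof (intro conjI allI impI)
        fix x y
        have 1: "u (x + y) \<le> a x + b y" if "a \<in> C" "b \<in> C" for a b
        proof -
          obtain d where d: "d \<in> C" "d \<le> a" "d \<le> b" using tot[of a b] \<open>a \<in> C\<close> \<open>b \<in> C\<close> by blast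
          then have "sublinear d" using CA by (auto simp: A_def)
          then have "u (x + y) \<le> d x + d y"
            using low[OF d(1), of "x + y"] sublinear_add[of d x y] by simp
          then show ?thesis using le_funD[OF d(2), of x] le_funD[OF d(3), of y] by simp
        qed
        have "u (x + y) - a x \<le> u y" if "a \<in> C" for a
          using 1[OF that] by (intro gre) (simp add: algebra_simps)
        then have "u (x + y) - u y \<le> u x"
          by (intro gre) (simp add: algebra_simps)
        then show "u (x + y) \<le> u x + u y" by simp
      next
        fix t :: real and x assume "t \<ge> 0"
        show "u (t *\<^sub>R x) \<le> t * u x"
        proof (cases "t = 0")
          case True
          obtain a where "a \<in> C" using False by blast
          then show ?thesis using low[of a 0] CA True by (auto simp: A_def sublinear_0)
        next
          case False
          then have "t > 0" using \<open>t \<ge> 0\<close> by simp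
          have "u (t *\<^sub>R x) / t \<le> u x"
          proof (rule gre)
            fix a assume "a \<in> C"
            then have "sublinear a" using CA by (auto simp: A_def)
            then have "u (t *\<^sub>R x) \<le> t * a x"
              using low[OF \<open>a \<in> C\<close>, of "t *\<^sub>R x"] \<open>t \<ge> 0\<close> by (simp add: sublinear_scale)
            then show "u (t *\<^sub>R x) / t \<le> a x" using \<open>t > 0\<close> by (simp add: pos_divide_le_eq mult.commute)
          qed
          then show ?thesis using \<open>t > 0\<close> by (simp add: pos_divide_le_eq mult.commute)
        qed
      qed
      moreover have "u \<le> p"
      proof -
        obtain a where "a \<in> C" using False by blast
        then show ?thesis using low[of a] CA by (auto simp: A_def le_fun_def intro: order_trans)
      qed
      ultimately have "u \<in> A" by (simp add: A_def)
      then show ?thesis using low by (auto simp: le_fun_def)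
    qed
  qed
  then obtain m where m: "m \<in> A" "\<And>a. a \<in> A \<Longrightarrow> a \<le> m \<Longrightarrow> a = m" by blast
  show thesis
  proof (rule that)
    show "sublinear m" "m x \<le> p x" for x using m(1) by (auto simp: A_def le_fun_def)
    fix q' assume "sublinear q'" "\<And>x. q' x \<le> m x"
    moreover from this have "q' \<le> p" using m(1) by (auto simp: A_def le_fun_def intro: order_trans)
    ultimately show "q' = m" using m(2)[of q'] by (auto simp: A_def le_fun_def)
  qed
qed

text \<open>
  The Hahn-Banach theorem in the form used here: a minimal sublinear functional below the tilt
  of the norm at \<open>z\<close> is linear, has norm at most 1, and is at most \<open>- norm z\<close> at \<open>- z\<close>.
\<close>

lemma ex_norming_functional:
  fixes z :: "'a::real_normed_vector"
  obtains \<phi> :: "'a \<Rightarrow>\<^sub>L real" where "norm \<phi> \<le> 1" "blinfun_apply \<phi> z = norm z"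
proof -
  have p: "sublinear (tilt norm z)" by (intro sublinear_tilt sublinear_norm)
  obtain q where q: "sublinear q" "\<And>x. q x \<le> tilt norm z x"
    and min: "\<And>q'. sublinear q' \<Longrightarrow> (\<And>x. q' x \<le> q x) \<Longrightarrow> q' = q"
    using ex_minimal_sublinear[OF p] by blast
  have lin: "linear q" by (rule linear_if_minimal_sublinear[OF q(1) min])
  have le: "q x \<le> norm x" for x
    using q(2)[of x] tilt_le_self[OF sublinear_norm, of z x] by simp
  have neg: "q (- x) = - q x" for x using linear_neg[OF lin] .
  have abs: "\<bar>q x\<bar> \<le> norm x" for x
    using le[of x] le[of "- x"] neg[of x] by simp
  have bl: "bounded_linear q"
    using abs by (intro bounded_linear_intro[where K = 1])
      (auto simp: linear_add[OF lin] linear_scale[OF lin])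
  show thesis
  proof (rule that)
    show "norm (Blinfun q) \<le> 1"
      by (rule norm_blinfun_bound) (use abs in \<open>auto simp: bounded_linear_Blinfun_apply[OF bl]\<close>)
    have "q (- z) \<le> - norm z" using q(2)[of "- z"] tilt_neg[OF sublinear_norm, of z] by simp
    then have "q z = norm z" using le[of z] neg[of z] by simp
    then show "blinfun_apply (Blinfun q) z = norm z" by (simp add: bounded_linear_Blinfun_apply[OF bl])
  qed
qed

section \<open>The symmetric logarithm and covers of almost homogeneous sets\<close>

lemma slog_ge_abs_ln:
  assumes "x > 0" shows "\<bar>ln x\<bar> \<le> slog x"
proof -
  have "ln x \<le> slog x" unfolding slog_def using assms by (subst ln_le_cancel_iff) (auto intro: add_pos_pos)
  moreover have "ln (inverse x) \<le> slog x" unfolding slog_def using assms by (subst ln_le_cancel_iff) (auto intro: add_pos_pos)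
  ultimately show ?thesis using assms by (simp add: ln_inverse)
qed

lemma slog_le_abs_ln:
  assumes "x > 0" shows "slog x \<le> ln 2 + \<bar>ln x\<bar>"
proof -
  define m where "m = max x (inverse x)"
  have "m > 0" using assms by (simp add: m_def)
  have "slog x \<le> ln (2 * m)" unfolding slog_def using assms \<open>m > 0\<close>
    by (subst ln_le_cancel_iff) (auto intro: add_pos_pos simp: m_def)
  also have "\<dots> = ln 2 + ln m" using \<open>m > 0\<close> by (simp add: ln_mult)
  also have "ln m \<le> \<bar>ln x\<bar>" using assms by (auto simp: m_def max_def ln_inverse)
  finally show ?thesis by simp
qed

lemma slog_ge_ln2:
  assumes "x > 0" shows "ln 2 \<le> slog x"
proof -
  have "0 \<le> (x - 1)\<^sup>2" by simp
  then have "2 \<le> x + inverse x" using assms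
    by (simp add: power2_eq_square field_simps)
  then show ?thesis unfolding slog_def by (subst ln_le_cancel_iff) auto
qed

text \<open>
  A covering number bounded by a real number is finite, and an infimum of a nonempty set of
  extended naturals is attained; so the analytic bound provides an actual cover.
\<close>

lemma almost_homogeneous_cover:
  assumes hom: "almost_homogeneous_with \<alpha> \<beta> M s Y"
    and r: "0 < \<rho>" "\<rho> < r" and x: "x \<in> Y"
  obtains C where "finite C" "C \<subseteq> Y" "Y \<inter> ball x r \<subseteq> (\<Union>c\<in>C. ball c \<rho>)"
    "real (card C) \<le> M * (r / \<rho>) powr s * slog r powr \<beta> * slog \<rho> powr \<alpha>"
proof -
  define b where "b = M * (r / \<rho>) powr s * slog r powr \<beta> * slog \<rho> powr \<alpha>"
  define A where "A = {enat n | n. \<forall>x\<in>Y. \<exists>C\<subseteq>Y. finite C \<and> card C \<le> n \<and>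
       Y \<inter> ball x r \<subseteq> (\<Union>c\<in>C. Y \<inter> ball c \<rho>)}"
  have "ereal_of_enat (covering_number Y r \<rho>) \<le> ereal b"
    using hom r unfolding almost_homogeneous_with_def b_def by blast
  then have le: "ereal_of_enat (Inf A) \<le> ereal b"
    by (simp only: covering_number_def A_def)
  then have "Inf A \<noteq> \<infinity>" by (cases "Inf A") auto
  then have "A \<noteq> {}" by (auto simp: Inf_enat_def)
  then have "Inf A \<in> A" using wellorder_InfI by blast
  then obtain n where n: "Inf A = enat n" and
    "\<forall>x\<in>Y. \<exists>C\<subseteq>Y. finite C \<and> card C \<le> n \<and> Y \<inter> ball x r \<subseteq> (\<Union>c\<in>C. Y \<inter> ball c \<rho>)"
    unfolding A_def by blast
  then obtain C where C: "C \<subseteq> Y" "finite C" "card C \<le> n" "Y \<inter> ball x r \<subseteq> (\<Union>c\<in>C. Y \<inter> ball c \<rho>)"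
    using x by blast
  show thesis
  proof (rule that)
    show "Y \<inter> ball x r \<subseteq> (\<Union>c\<in>C. ball c \<rho>)" using C(4) by blast
    have "real n \<le> b" using le unfolding n by simp
    then show "real (card C) \<le> M * (r / \<rho>) powr s * slog r powr \<beta> * slog \<rho> powr \<alpha>"
      using C(3) unfolding b_def by linarith
  qed (use C in auto)
qed

lemma almost_homogeneous_with_mono:
  assumes "almost_homogeneous_with \<alpha> \<beta> M s' Y" "s' \<le> s" "M \<ge> 0"
  shows "almost_homogeneous_with \<alpha> \<beta> M s Y"
  unfolding almost_homogeneous_with_def
proof (intro allI impI)
  fix r \<rho> :: real assume r: "0 < \<rho> \<and> \<rho> < r"
  then have "ereal_of_enat (covering_number Y r \<rho>)
      \<le> ereal (M * (r / \<rho>) powr s' * slog r powr \<beta> * slog \<rho> powr \<alpha>)"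
    using assms(1) unfolding almost_homogeneous_with_def by blast
  also have "\<dots> \<le> ereal (M * (r / \<rho>) powr s * slog r powr \<beta> * slog \<rho> powr \<alpha>)"
    using r assms by (auto intro!: mult_right_mono mult_left_mono powr_mono)
  finally show "ereal_of_enat (covering_number Y r \<rho>)
      \<le> ereal (M * (r / \<rho>) powr s * slog r powr \<beta> * slog \<rho> powr \<alpha>)" .
qed

lemma almost_homogeneous_if_assouad_dim_less:
  assumes "assouad_dim \<alpha> \<beta> Y < ereal s"
  obtains M where "M \<ge> 1" "almost_homogeneous_with \<alpha> \<beta> M s Y"
proof -
  obtain s' M where "0 \<le> s'" "M \<ge> 1" "almost_homogeneous_with \<alpha> \<beta> M s' Y" "s' < s"
    using assms unfolding assouad_dim_def Inf_less_iff by auto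
  then show thesis using that[of M] almost_homogeneous_with_mono[of \<alpha> \<beta> M s' Y s] by auto
qed

lemma almost_homogeneous_cover_0:
  assumes "almost_homogeneous_with \<alpha> \<beta> M s Y" "Y = {} \<or> 0 \<in> Y" "M \<ge> 0" "0 < \<rho>" "\<rho> < r"
  obtains C where "finite C" "C \<subseteq> Y" "Y \<inter> ball 0 r \<subseteq> (\<Union>c\<in>C. ball c \<rho>)"
    "real (card C) \<le> M * (r / \<rho>) powr s * slog r powr \<beta> * slog \<rho> powr \<alpha>"
proof (cases "Y = {}")
  case True
  then show thesis using that[of "{}"] assms(3) by simp
next
  case False
  show thesis
    by (rule almost_homogeneous_cover[OF assms(1,4,5)]) (use False assms(2) in \<open>auto intro: that\<close>)
qed

text \<open>
  On dyadic scales the logarithmic factors of almost homogeneity are linear in the index \<open>j\<close>.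
  The power of \<open>j + 1\<close> and the divisor \<open>q\<close> are those of the thresholds of the small value
  estimates; the dependence on \<open>q\<close> is made explicit because \<open>q\<close> tends to infinity at the end.
\<close>

lemma slog_dyadic_le:
  assumes "D > 0" "\<gamma> \<ge> 0" "q \<ge> 1"
  shows "slog (D / 2 ^ j * (real j + 1) powr (- \<gamma>) / q)
    \<le> (2 + \<bar>ln D\<bar> + \<gamma>) * (real j + 1) * (1 + ln q)"
proof -
  let ?x = "D / 2 ^ j * (real j + 1) powr (- \<gamma>) / q"
  have "?x > 0" using assms by simp
  have q: "ln q \<ge> 0" using assms by simp
  have ln2: "ln 2 \<le> (1::real)" using ln_le_minus_one[of "2::real"] by simp
  have lnj: "0 \<le> ln (real j + 1)" "ln (real j + 1) \<le> real j"
    using ln_add_one_self_le_self[of "real j"] by (auto simp: add.commute)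
  have "ln ?x = ln D - real j * ln 2 - \<gamma> * ln (real j + 1) - ln q"
    using assms by (simp add: ln_div ln_mult ln_powr ln_realpow)
  moreover have "0 \<le> real j * ln 2" "real j * ln 2 \<le> real j"
    using ln2 by (auto intro: mult_left_le)
  moreover have "0 \<le> \<gamma> * ln (real j + 1)" "\<gamma> * ln (real j + 1) \<le> \<gamma> * real j"
    using lnj assms by (auto intro: mult_left_mono)
  ultimately have "\<bar>ln ?x\<bar> \<le> \<bar>ln D\<bar> + real j + \<gamma> * real j + ln q"
    using q by linarith
  then have "slog ?x \<le> 1 + \<bar>ln D\<bar> + real j + \<gamma> * real j + ln q"
    using slog_le_abs_ln[OF \<open>?x > 0\<close>] ln2 by linarith
  also have "1 + \<bar>ln D\<bar> + real j + \<gamma> * real j \<le> (2 + \<bar>ln D\<bar> + \<gamma>) * (real j + 1)" (is "_ \<le> ?A")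
    using assms by (simp add: algebra_simps)
  also have "?A + ln q \<le> ?A * (1 + ln q)"
  proof -
    have "1 * 1 \<le> (2 + \<bar>ln D\<bar> + \<gamma>) * (real j + 1)"
      using assms by (intro mult_mono) auto
    then have "1 * ln q \<le> ?A * ln q" using q by (intro mult_right_mono) auto
    then show ?thesis by (simp add: algebra_simps)
  qed
  finally show ?thesis by simp
qed

text \<open>
  Conversely, \<open>slog\<close> controls the dyadic index, which turns thresholds stated with powers of
  \<open>j + 1\<close> into ones with powers of \<open>slog\<close>. The constant comes from \<open>slog x \<ge> \<bar>ln x\<bar>\<close> and
  \<open>slog x \<ge> ln 2\<close>.
\<close>

lemma dyadic_index_le_slog:
  assumes "D > 0" "0 < x" "x \<le> D / 2 ^ j"
  shows "real j + 1 \<le> (2 + \<bar>ln D\<bar> / ln 2) / ln 2 * slog x"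
proof -
  have l: "ln (2::real) > 0" by simp
  have "ln x \<le> ln (D / 2 ^ j)" using assms by (subst ln_le_cancel_iff) auto
  also have "\<dots> = ln D - real j * ln 2" using assms by (simp add: ln_div ln_realpow)
  finally have "real j * ln 2 \<le> \<bar>ln D\<bar> + slog x"
    using slog_ge_abs_ln[OF assms(2)] by linarith
  moreover have "\<bar>ln D\<bar> \<le> \<bar>ln D\<bar> / ln 2 * slog x"
    using mult_left_mono[OF slog_ge_ln2[OF assms(2)], of "\<bar>ln D\<bar> / ln 2"] by simp
  ultimately have "(real j + 1) * ln 2 \<le> (2 + \<bar>ln D\<bar> / ln 2) * slog x"
    using slog_ge_ln2[OF assms(2)] by (simp add: algebra_simps)
  then show ?thesis using l by (simp add: pos_le_divide_eq)
qed

section \<open>Functionals that norm the dyadic shells\<close>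

text \<open>
  A functional that norms a centre almost norms the points near it: passing from the centre to
  the point costs \<open>\<rho>\<close> in the norm and \<open>\<rho>\<close> in the value of the functional.
\<close>

lemma norming_functionals_of_cover:
  fixes A :: "'b::real_normed_vector set"
  assumes C: "finite C" "A \<subseteq> (\<Union>c\<in>C. ball c \<rho>)"
  obtains \<phi> :: "nat \<Rightarrow> 'b \<Rightarrow>\<^sub>L real" where "\<And>k. norm (\<phi> k) \<le> 1"
    "\<And>z. z \<in> A \<Longrightarrow> \<exists>k<card C. norm z - 2 * \<rho> \<le> blinfun_apply (\<phi> k) z"
proof -
  obtain e where e: "bij_betw e {0..<card C} C" using ex_bij_betw_nat_finite[OF C(1)] by blast
  have "\<exists>\<psi> :: 'b \<Rightarrow>\<^sub>L real. norm \<psi> \<le> 1 \<and> blinfun_apply \<psi> (e k) = norm (e k)" for k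
    using ex_norming_functional[of "e k"] by metis
  then obtain \<phi> :: "nat \<Rightarrow> 'b \<Rightarrow>\<^sub>L real"
    where \<phi>: "\<And>k. norm (\<phi> k) \<le> 1" "\<And>k. blinfun_apply (\<phi> k) (e k) = norm (e k)" by metis
  show thesis
  proof (rule that[OF \<phi>(1)])
    fix z assume "z \<in> A"
    then obtain c where c: "c \<in> C" "dist c z < \<rho>" using C(2) by auto
    then have "c \<in> e ` {0..<card C}" using e by (simp add: bij_betw_def)
    then obtain k where k: "k < card C" "e k = c" by auto
    have "\<bar>blinfun_apply (\<phi> k) (c - z)\<bar> \<le> norm (c - z)"
      using norm_blinfun[of "\<phi> k" "c - z"] mult_right_mono[OF \<phi>(1)[of k], of "norm (c - z)"] by simp
    moreover have "blinfun_apply (\<phi> k) (c - z) = norm c - blinfun_apply (\<phi> k) z"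
      using \<phi>(2)[of k] k by (simp add: blinfun.diff_right)
    moreover have "norm z \<le> norm c + norm (c - z)"
      by (metis norm_triangle_sub norm_minus_commute)
    ultimately have "norm z - 2 * \<rho> \<le> blinfun_apply (\<phi> k) z"
      using c(2) by (simp add: dist_norm)
    then show "\<exists>k<card C. norm z - 2 * \<rho> \<le> blinfun_apply (\<phi> k) z" using k(1) by blast
  qed
qed

text \<open>
  Covering \<open>Y\<close> near scale \<open>D / 2 ^ j\<close> by balls whose radius is a fixed fraction of the scale
  takes only about \<open>(j + 1) powr (\<alpha> + \<beta>)\<close> balls, because the ratio of the radii is constant
  and only the logarithmic factors grow. Hence so few functionals suffice for the scale. The
  range of norms is wider than the dyadic shell in order to include nearby centres.
\<close>

lemma ex_shell_norming_functionals:
  fixes Y :: "'b::real_normed_vector set"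
  assumes "\<alpha> \<ge> 0" "\<beta> \<ge> 0" "M > 0" and hom: "almost_homogeneous_with \<alpha> \<beta> M s Y"
    and "D > 0" and Y0: "Y = {} \<or> 0 \<in> Y"
  obtains K and m :: "nat \<Rightarrow> nat" and \<phi> :: "nat \<Rightarrow> nat \<Rightarrow> 'b \<Rightarrow>\<^sub>L real" where "K > 0"
    "\<And>j. real (m j) \<le> K * (real j + 1) powr (\<alpha> + \<beta>)"
    "\<And>j k. norm (\<phi> j k) \<le> 1"
    "\<And>j z. z \<in> Y \<Longrightarrow> D / 2 ^ j / 4 \<le> norm z \<Longrightarrow> norm z < 2 * (D / 2 ^ j) \<Longrightarrow>
      \<exists>k<m j. D / 2 ^ j / 8 \<le> blinfun_apply (\<phi> j k) z"
proof -
  define K1 where "K1 = 2 + \<bar>ln (2 * D)\<bar>"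
  define K2 where "K2 = 2 + \<bar>ln (D / 16)\<bar>"
  define K where "K = M * 32 powr s * K1 powr \<beta> * K2 powr \<alpha>"
  have pos: "K1 > 0" "K2 > 0" "K > 0" using \<open>M > 0\<close> by (auto simp: K_def K1_def K2_def add_pos_nonneg)
  have "\<exists>m (\<phi> :: nat \<Rightarrow> 'b \<Rightarrow>\<^sub>L real). real m \<le> K * (real j + 1) powr (\<alpha> + \<beta>) \<and> (\<forall>k. norm (\<phi> k) \<le> 1) \<and>
      (\<forall>z\<in>Y. D / 2 ^ j / 4 \<le> norm z \<longrightarrow> norm z < 2 * (D / 2 ^ j) \<longrightarrow>
        (\<exists>k<m. D / 2 ^ j / 8 \<le> blinfun_apply (\<phi> k) z))" for j
  proof -
    define d where "d = D / 2 ^ j"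
    have "d > 0" using \<open>D > 0\<close> by (simp add: d_def)
    have s1: "slog (2 * d) \<le> K1 * (real j + 1)"
      using slog_dyadic_le[of "2 * D" 0 1 j] \<open>D > 0\<close> by (simp add: d_def K1_def)
    have s2: "slog (d / 16) \<le> K2 * (real j + 1)"
      using slog_dyadic_le[of "D / 16" 0 1 j] \<open>D > 0\<close> by (simp add: d_def K2_def mult.commute)
    have s0: "0 \<le> slog (2 * d)" "0 \<le> slog (d / 16)"
      using slog_ge_abs_ln[of "2 * d"] slog_ge_abs_ln[of "d / 16"] \<open>d > 0\<close> by auto
    \<comment> \<open>The ratio of the radii is the constant 32. A point of norm at least \<open>d / 4\<close> loses
      \<open>2 * (d / 16)\<close> when its centre is normed, so that \<open>d / 8\<close> remains.\<close>
    have d16: "0 < d / 16" "d / 16 < 2 * d" using \<open>d > 0\<close> by auto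
    obtain C where C: "finite C" "C \<subseteq> Y" "Y \<inter> ball 0 (2 * d) \<subseteq> (\<Union>c\<in>C. ball c (d / 16))"
      and card: "real (card C) \<le> M * (2 * d / (d / 16)) powr s * slog (2 * d) powr \<beta> * slog (d / 16) powr \<alpha>"
      by (rule almost_homogeneous_cover_0[OF hom Y0 less_imp_le[OF \<open>M > 0\<close>] d16]) (rule that)
    have "real (card C) \<le> M * 32 powr s * slog (2 * d) powr \<beta> * slog (d / 16) powr \<alpha>"
      using card \<open>d > 0\<close> by simp
    also have "\<dots> \<le> M * 32 powr s * (K1 * (real j + 1)) powr \<beta> * (K2 * (real j + 1)) powr \<alpha>"
      using s0 s1 s2 \<open>M > 0\<close> assms(1,2)
      by (intro mult_mono powr_mono2 mult_nonneg_nonneg order_refl) auto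
    also have "\<dots> = K * (real j + 1) powr (\<alpha> + \<beta>)"
      using pos by (simp add: K_def powr_mult powr_add)
    finally have m: "real (card C) \<le> K * (real j + 1) powr (\<alpha> + \<beta>)" .
    obtain \<phi> :: "nat \<Rightarrow> 'b \<Rightarrow>\<^sub>L real" where \<phi>: "\<And>k. norm (\<phi> k) \<le> 1"
      "\<And>z. z \<in> Y \<inter> ball 0 (2 * d) \<Longrightarrow> \<exists>k<card C. norm z - 2 * (d / 16) \<le> blinfun_apply (\<phi> k) z"
      using norming_functionals_of_cover[OF C(1,3)] by blast
    have "\<exists>k<card C. d / 8 \<le> blinfun_apply (\<phi> k) z" if z: "z \<in> Y" "d / 4 \<le> norm z" "norm z < 2 * d" for z
    proof -
      obtain k where "k < card C" "norm z - 2 * (d / 16) \<le> blinfun_apply (\<phi> k) z"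
        using \<phi>(2)[of z] z by auto
      then show ?thesis using z by (intro exI[of _ k]) auto
    qed
    then show ?thesis
      using m \<phi>(1) unfolding d_def[symmetric] by (intro exI[of _ "card C"] exI[of _ \<phi>]) auto
  qed
  then obtain m and \<phi> :: "nat \<Rightarrow> nat \<Rightarrow> 'b \<Rightarrow>\<^sub>L real" where
    "\<And>j. real (m j) \<le> K * (real j + 1) powr (\<alpha> + \<beta>) \<and> (\<forall>k. norm (\<phi> j k) \<le> 1) \<and>
      (\<forall>z\<in>Y. D / 2 ^ j / 4 \<le> norm z \<longrightarrow> norm z < 2 * (D / 2 ^ j) \<longrightarrow>
        (\<exists>k<m j. D / 2 ^ j / 8 \<le> blinfun_apply (\<phi> j k) z))" by metis
  then show thesis using pos(3) by (intro that[of K m \<phi>]) auto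
qed

section \<open>The random operator and its small ball estimate\<close>

text \<open>
  The radial retraction onto the closed unit ball. Applied to the random coefficients it
  changes nothing almost surely, but it makes the random series converge uniformly on the
  whole coefficient space, so that its sum is continuous and therefore Borel measurable even
  if the space of operators is not separable.
\<close>

definition retract :: "'c::real_normed_vector \<Rightarrow> 'c" where
  "retract u = u /\<^sub>R max 1 (norm u)"

lemma norm_retract_le: "norm (retract u) \<le> 1"
  by (auto simp: retract_def max_def field_simps)

lemma retract_id: "norm u \<le> 1 \<Longrightarrow> retract u = u"
  by (simp add: retract_def max_def)

lemma continuous_on_retract: "continuous_on UNIV (retract :: 'c::real_normed_vector \<Rightarrow> 'c)"
  unfolding retract_def by (intro continuous_intros) (auto simp: max_def)

definition rank_one :: "('b::real_normed_vector \<Rightarrow>\<^sub>L real) \<Rightarrow> 'c::real_normed_vector \<Rightarrow> 'b \<Rightarrow>\<^sub>L 'c" where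
  "rank_one \<phi> u = blinfun_scaleR_left u o\<^sub>L \<phi>"

lemma rank_one_apply [simp]: "blinfun_apply (rank_one \<phi> u) z = blinfun_apply \<phi> z *\<^sub>R u"
  by (simp add: rank_one_def)

lemma norm_rank_one_le: "norm (rank_one \<phi> u) \<le> norm \<phi> * norm u"
proof (rule norm_blinfun_bound)
  fix z
  have "norm (blinfun_apply \<phi> z) * norm u \<le> (norm \<phi> * norm z) * norm u"
    by (intro mult_right_mono norm_blinfun) auto
  then show "norm (blinfun_apply (rank_one \<phi> u) z) \<le> norm \<phi> * norm u * norm z"
    by (simp add: mult_ac)
qed simp

lemma continuous_on_rank_one: "continuous_on UNIV (rank_one \<phi>)"
  unfolding rank_one_def
  by (intro bounded_bilinear.continuous_on[OF bounded_bilinear_blinfun_compose] continuous_on_const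
      bounded_linear.continuous_on[OF bounded_linear_blinfun_scaleR_left] continuous_on_id)

lemma summable_inverse_Suc_squares: "summable (\<lambda>j. 1 / (real j + 1)\<^sup>2)"
proof -
  have "summable (\<lambda>j. inverse (real (Suc j) ^ 2))"
    by (subst summable_Suc_iff) (rule inverse_power_summable, simp)
  then show ?thesis by (simp add: inverse_eq_divide add.commute)
qed

text \<open>
  Given finitely many functionals \<open>\<phi> j k\<close>, \<open>k < m j\<close>, in the unit ball of the dual for each
  scale \<open>j\<close>, the probe is the law of the random operator that sums \<open>\<phi> j k\<close> times a vector
  coefficient \<open>c (j, k)\<close> over all \<open>j\<close> and \<open>k\<close>, with coefficients that are independent and
  uniform in the unit ball. The weight \<open>1 / ((j + 1)\<^sup>2 m j)\<close> makes the sum over the layers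
  converge; it is also the price paid in the small ball estimate, and the squares account for
  the number 2 in the bound on \<open>\<gamma>\<close>.
\<close>

locale functional_layers =
  fixes m :: "nat \<Rightarrow> nat" and \<phi> :: "nat \<Rightarrow> nat \<Rightarrow> 'b::real_normed_vector \<Rightarrow>\<^sub>L real"
  assumes norm_functional: "norm (\<phi> j k) \<le> 1"
begin

definition weight :: "nat \<Rightarrow> real" where
  "weight j = 1 / ((real j + 1)\<^sup>2 * real (m j))"

definition layer :: "nat \<Rightarrow> (nat \<times> nat \<Rightarrow> 'c::euclidean_space) \<Rightarrow> 'b \<Rightarrow>\<^sub>L 'c" where
  "layer j c = (\<Sum>k<m j. weight j *\<^sub>R rank_one (\<phi> j k) (retract (c (j, k))))"

definition random_map :: "(nat \<times> nat \<Rightarrow> 'c::euclidean_space) \<Rightarrow> 'b \<Rightarrow>\<^sub>L 'c" where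
  "random_map c = (\<Sum>j. layer j c)"

lemma norm_layer_le: "norm (layer j c) \<le> 1 / (real j + 1)\<^sup>2"
proof -
  have "norm (rank_one (\<phi> j k) (retract (c (j, k)))) \<le> 1" for k
    using norm_rank_one_le[of "\<phi> j k" "retract (c (j, k))"]
      mult_mono[OF norm_functional[of j k] norm_retract_le[of "c (j, k)"]] by simp
  then have "norm (weight j *\<^sub>R rank_one (\<phi> j k) (retract (c (j, k)))) \<le> weight j" for k
    using mult_left_mono[of _ 1 "weight j"] by (simp add: weight_def)
  then have "norm (layer j c) \<le> (\<Sum>k<m j. weight j)"
    unfolding layer_def by (rule sum_norm_le)
  also have "\<dots> \<le> 1 / (real j + 1)\<^sup>2" by (simp add: weight_def)
  finally show ?thesis .
qed

lemma summable_layer: "summable (\<lambda>j. layer j c)"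
  by (rule summable_comparison_test[OF _ summable_inverse_Suc_squares]) (use norm_layer_le in auto)

lemma norm_random_map_le: "norm (random_map c) \<le> (\<Sum>j. 1 / (real j + 1)\<^sup>2)"
  unfolding random_map_def
  by (rule norm_suminf_le[OF norm_layer_le summable_inverse_Suc_squares])

lemma continuous_on_layer: "continuous_on UNIV (layer j)"
  unfolding layer_def[abs_def]
  by (intro continuous_intros continuous_on_compose2[OF continuous_on_rank_one]
      continuous_on_compose2[OF continuous_on_retract] continuous_on_product_coordinates) auto

lemma continuous_on_random_map: "continuous_on UNIV random_map"
proof (rule uniform_limit_theorem)
  show "uniform_limit UNIV (\<lambda>n c. \<Sum>j<n. layer j c) random_map sequentially"
    unfolding random_map_def[abs_def]
    by (rule Weierstrass_m_test[OF norm_layer_le summable_inverse_Suc_squares])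
  show "\<forall>\<^sub>F n in sequentially. continuous_on UNIV (\<lambda>c. \<Sum>j<n. layer j c)"
    by (intro always_eventually allI continuous_on_sum continuous_on_layer)
qed simp

lemma layer_upd:
  fixes u :: "'c::euclidean_space"
  assumes "k < m j"
  shows "layer i (c((j, k) := u)) =
    layer i (c((j, k) := 0)) + (if i = j then weight j *\<^sub>R rank_one (\<phi> j k) (retract u) else 0)"
proof (cases "i = j")
  case True
  have 1: "layer j d = weight j *\<^sub>R rank_one (\<phi> j k) (retract (d (j, k))) +
      (\<Sum>l\<in>{..<m j} - {k}. weight j *\<^sub>R rank_one (\<phi> j l) (retract (d (j, l))))" for d
    unfolding layer_def using assms by (intro sum.remove) auto
  have 2: "(\<Sum>l\<in>{..<m j} - {k}. weight j *\<^sub>R rank_one (\<phi> j l) (retract ((c((j, k) := v)) (j, l)))) =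
      (\<Sum>l\<in>{..<m j} - {k}. weight j *\<^sub>R rank_one (\<phi> j l) (retract (c (j, l))))" for v
    by (rule sum.cong) auto
  have "rank_one (\<phi> j k) (retract 0 :: 'c) = 0"
    by (rule blinfun_eqI) (simp add: retract_def)
  then show ?thesis using True by (simp only: 1 2) simp
qed (simp add: layer_def)

text \<open>
  As a function of a single coefficient the random map is affine on the unit ball, with slope
  the rank one operator that this coefficient multiplies.
\<close>

lemma random_map_upd:
  assumes "k < m j"
  shows "random_map (c((j, k) := u)) =
    random_map (c((j, k) := 0)) + weight j *\<^sub>R rank_one (\<phi> j k) (retract u)"
proof -
  let ?g = "\<lambda>i. if i = j then weight j *\<^sub>R rank_one (\<phi> j k) (retract u) else 0"
  have "?g sums (weight j *\<^sub>R rank_one (\<phi> j k) (retract u))"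
    using sums_If_finite_set[of "{j}" "\<lambda>i. weight j *\<^sub>R rank_one (\<phi> j k) (retract u)"] by simp
  then have g: "summable ?g" "suminf ?g = weight j *\<^sub>R rank_one (\<phi> j k) (retract u)"
    by (auto simp: sums_iff)
  have "random_map (c((j, k) := u)) = (\<Sum>i. layer i (c((j, k) := 0)) + ?g i)"
    unfolding random_map_def by (subst layer_upd[OF assms]) simp
  also have "\<dots> = random_map (c((j, k) := 0)) + suminf ?g"
    unfolding random_map_def by (rule suminf_add[OF summable_layer g(1), symmetric])
  finally show ?thesis by (simp add: g(2))
qed

end

definition unit_ball_measure :: "'c::euclidean_space measure" where
  "unit_ball_measure = uniform_measure lborel (cball 0 1)"

definition coeff_measure :: "(nat \<times> nat \<Rightarrow> 'c::euclidean_space) measure" where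
  "coeff_measure = PiM UNIV (\<lambda>_. unit_ball_measure)"

lemma unit_ball_vol_nonzero: "unit_ball_vol (real n) \<noteq> 0"
  using unit_ball_vol_pos[OF of_nat_0_le_iff[of n]] by (rule less_imp_neq[symmetric])

lemma prob_space_unit_ball_measure: "prob_space (unit_ball_measure :: 'c::euclidean_space measure)"
  unfolding unit_ball_measure_def
  by (rule prob_space_uniform_measure) (auto simp: emeasure_cball unit_ball_vol_nonzero)

lemma sets_unit_ball_measure [simp, measurable_cong]: "sets unit_ball_measure = sets borel"
  by (simp add: unit_ball_measure_def)

lemma sets_coeff_measure [simp, measurable_cong]:
  "sets (coeff_measure :: (nat \<times> nat \<Rightarrow> 'c::euclidean_space) measure) = sets borel"
proof -
  have "sets (coeff_measure :: (nat \<times> nat \<Rightarrow> 'c) measure) = sets (PiM UNIV (\<lambda>_. borel))"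
    unfolding coeff_measure_def by (rule sets_PiM_cong) auto
  then show ?thesis by (simp add: sets_PiM_equal_borel)
qed

lemma space_coeff_measure [simp]: "space coeff_measure = UNIV"
  using sets_eq_imp_space_eq[OF sets_coeff_measure] by simp

lemma prob_space_coeff_measure: "prob_space (coeff_measure :: (nat \<times> nat \<Rightarrow> 'c::euclidean_space) measure)"
  unfolding coeff_measure_def by (rule prob_space_PiM) (rule prob_space_unit_ball_measure)

text \<open>
  The affine map \<open>u \<mapsto> a + b *\<^sub>R u\<close> pulls a ball of radius \<open>\<eta>\<close> back to a ball of radius
  \<open>\<eta> / \<bar>b\<bar>\<close>; the volume of the unit ball cancels against the normalisation of the measure.
\<close>

lemma unit_ball_measure_small_ball:
  fixes a :: "'c::euclidean_space"
  assumes t: "0 < t" "t \<le> \<bar>b\<bar>" and "\<eta> > 0"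
    and B: "B \<in> sets borel" "\<And>u. norm u \<le> 1 \<Longrightarrow> u \<in> B \<Longrightarrow> norm (a + b *\<^sub>R u) < \<eta>"
  shows "emeasure unit_ball_measure B \<le> ennreal ((\<eta> / t) ^ DIM('c))"
proof -
  have "b \<noteq> 0" using t by auto
  let ?V = "unit_ball_vol (real DIM('c))"
  have V: "?V > 0" by simp
  have "cball 0 1 \<inter> B \<subseteq> ball (- a /\<^sub>R b) (\<eta> / t)"
  proof
    fix u assume "u \<in> cball 0 1 \<inter> B"
    then have "norm (a + b *\<^sub>R u) < \<eta>" using B(2)[of u] by simp
    also have "a + b *\<^sub>R u = b *\<^sub>R (u - (- a /\<^sub>R b))"
      using \<open>b \<noteq> 0\<close> by (simp add: scaleR_add_right)
    finally have "\<bar>b\<bar> * norm (u - (- a /\<^sub>R b)) < \<eta>" by simp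
    then have "t * norm (u - (- a /\<^sub>R b)) < \<eta>"
      using mult_right_mono[OF t(2), of "norm (u - (- a /\<^sub>R b))"] by simp
    then show "u \<in> ball (- a /\<^sub>R b) (\<eta> / t)"
      using t(1) by (simp add: dist_norm norm_minus_commute pos_less_divide_eq mult.commute)
  qed
  then have "emeasure lborel (cball 0 1 \<inter> B) \<le> emeasure lborel (ball (- a /\<^sub>R b) (\<eta> / t))"
    by (intro emeasure_mono) auto
  also have "\<dots> = ennreal (?V * (\<eta> / t) ^ DIM('c))"
    using assms by (intro emeasure_ball) simp
  finally have "emeasure unit_ball_measure B \<le> ennreal (?V * (\<eta> / t) ^ DIM('c)) / ennreal ?V"
    unfolding unit_ball_measure_def using B(1)
    by (subst emeasure_uniform_measure) (auto simp: emeasure_cball unit_ball_vol_nonzero intro: divide_right_mono_ennreal)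
  also have "\<dots> = ennreal ((\<eta> / t) ^ DIM('c))"
    using V assms by (simp add: divide_ennreal unit_ball_vol_nonzero)
  finally show ?thesis .
qed

context functional_layers
begin

lemma random_map_measurable [measurable]:
  "(random_map :: (nat \<times> nat \<Rightarrow> 'c::euclidean_space) \<Rightarrow> _) \<in> borel_measurable coeff_measure"
  using borel_measurable_continuous_onI[OF continuous_on_random_map]
    measurable_cong_sets[OF sets_coeff_measure refl] by blast

text \<open>
  Fubini: freeze all coefficients except the one at \<open>(j, k)\<close>. The value at \<open>z\<close> then is affine
  in a uniform vector of the unit ball, with slope at least \<open>weight j * t\<close> in absolute value,
  whatever the frozen coefficients are. Since the bound is uniform in \<open>w\<close>, it serves for every
  translate of the probe.
\<close>

lemma small_ball_estimate:
  fixes w :: "'c::euclidean_space"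
  assumes k: "k < m j" and t: "0 < t" "t \<le> \<bar>blinfun_apply (\<phi> j k) z\<bar>" and "\<eta> > 0"
  shows "emeasure coeff_measure {c. norm (blinfun_apply (random_map c) z - w) < \<eta>}
    \<le> ennreal ((\<eta> / (weight j * t)) ^ DIM('c))"
proof -
  let ?A = "{c :: nat \<times> nat \<Rightarrow> 'c. norm (blinfun_apply (random_map c) z - w) < \<eta>}"
  let ?U = "unit_ball_measure :: 'c measure"
  let ?P = "coeff_measure :: (nat \<times> nat \<Rightarrow> 'c) measure"
  let ?h = "\<lambda>(u, c). c((j, k) := u) :: nat \<times> nat \<Rightarrow> 'c"
  let ?B = "\<lambda>c. {u. c((j, k) := u) \<in> ?A}"
  interpret U: prob_space ?U by (rule prob_space_unit_ball_measure)
  interpret P: prob_space ?P by (rule prob_space_coeff_measure)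
  interpret UP: pair_sigma_finite ?U ?P ..
  have w: "weight j > 0" using k by (simp add: weight_def)
  have open_A: "open ?A"
    by (intro open_Collect_less continuous_intros blinfun.continuous_on continuous_on_random_map)
  then have A: "?A \<in> sets ?P" by simp
  have h: "?h \<in> measurable (?U \<Otimes>\<^sub>M ?P) ?P"
    unfolding coeff_measure_def split_beta' by (intro measurable_fun_upd[where J = UNIV]) auto
  \<comment> \<open>Resampling one coordinate independently leaves the product measure invariant.\<close>
  have "?P = distr (?U \<Otimes>\<^sub>M ?P) ?P ?h"
    using distr_pair_PiM_eq_PiM[of "UNIV :: (nat \<times> nat) set" "\<lambda>_. ?U" "(j, k)"]
    by (simp add: coeff_measure_def prob_space_unit_ball_measure)
  then have "emeasure ?P ?A = emeasure (?U \<Otimes>\<^sub>M ?P) (?h -` ?A \<inter> space (?U \<Otimes>\<^sub>M ?P))"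
    using emeasure_distr[OF h A] by simp
  also have "\<dots> = (\<integral>\<^sup>+ c. emeasure ?U ((\<lambda>u. (u, c)) -` (?h -` ?A \<inter> space (?U \<Otimes>\<^sub>M ?P))) \<partial>?P)"
    by (rule UP.emeasure_pair_measure_alt2[OF measurable_sets[OF h A]])
  also have "\<dots> \<le> (\<integral>\<^sup>+ c. ennreal ((\<eta> / (weight j * t)) ^ DIM('c)) \<partial>?P)"
  proof (rule nn_integral_mono)
    fix c
    show "emeasure ?U ((\<lambda>u. (u, c)) -` (?h -` ?A \<inter> space (?U \<Otimes>\<^sub>M ?P)))
        \<le> ennreal ((\<eta> / (weight j * t)) ^ DIM('c))"
    proof (rule unit_ball_measure_small_ball)
      show "0 < weight j * t" using w t by simp
      show "weight j * t \<le> \<bar>weight j * blinfun_apply (\<phi> j k) z\<bar>"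
        using w t by (simp add: abs_mult)
      show "\<eta> > 0" by fact
      show "(\<lambda>u. (u, c)) -` (?h -` ?A \<inter> space (?U \<Otimes>\<^sub>M ?P)) \<in> sets borel"
        using sets_Pair2[OF measurable_sets[OF h A], of c] by simp
      fix u :: 'c assume "norm u \<le> 1" and u: "u \<in> (\<lambda>u. (u, c)) -` (?h -` ?A \<inter> space (?U \<Otimes>\<^sub>M ?P))"
      then have "norm (blinfun_apply (random_map (c((j, k) := u))) z - w) < \<eta>" by simp
      then show "norm ((blinfun_apply (random_map (c((j, k) := 0))) z - w) +
          (weight j * blinfun_apply (\<phi> j k) z) *\<^sub>R u) < \<eta>"
        by (subst (asm) random_map_upd[OF k])
          (simp add: retract_id[OF \<open>norm u \<le> 1\<close>] blinfun.add_left blinfun.scaleR_left algebra_simps)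
    qed
  qed
  also have "\<dots> = ennreal ((\<eta> / (weight j * t)) ^ DIM('c))"
    by (simp add: P.emeasure_space_1[simplified])
  finally show ?thesis .
qed

definition probe_measure :: "('b \<Rightarrow>\<^sub>L 'c::euclidean_space) measure" where
  "probe_measure = distr coeff_measure borel random_map"

lemma prob_space_probe_measure: "prob_space (probe_measure :: ('b \<Rightarrow>\<^sub>L 'c::euclidean_space) measure)"
  unfolding probe_measure_def
  by (rule prob_space.prob_space_distr[OF prob_space_coeff_measure random_map_measurable])

text \<open>
  By Tychonoff the coefficients in the unit ball form a compact set, and its image carries the
  whole probe, because retracting the coefficients does not change the random map.
\<close>

lemma probe_measure_compact:
  "\<exists>K. compact K \<and> emeasure (probe_measure :: ('b \<Rightarrow>\<^sub>L 'c::euclidean_space) measure) K = 1"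
proof -
  interpret P: prob_space "coeff_measure :: (nat \<times> nat \<Rightarrow> 'c) measure"
    by (rule prob_space_coeff_measure)
  let ?C = "PiE UNIV (\<lambda>_. cball 0 1) :: (nat \<times> nat \<Rightarrow> 'c) set"
  let ?K = "random_map ` ?C"
  have "compactin (product_topology (\<lambda>_. euclidean) UNIV) ?C"
    by (simp add: compactin_PiE)
  then have "compact ?C" by (simp add: euclidean_product_topology)
  then have K: "compact ?K"
    by (intro compact_continuous_image continuous_on_subset[OF continuous_on_random_map]) auto
  have "random_map c \<in> ?K" for c :: "nat \<times> nat \<Rightarrow> 'c"
  proof
    show "random_map c = random_map (\<lambda>i. retract (c i))"
      by (simp add: random_map_def layer_def retract_id norm_retract_le)
    show "(\<lambda>i. retract (c i)) \<in> ?C" by (simp add: PiE_iff norm_retract_le)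
  qed
  then have "random_map -` ?K = UNIV" by auto
  then have "emeasure probe_measure ?K = 1"
    unfolding probe_measure_def using compact_imp_closed[OF K] P.emeasure_space_1
    by (subst emeasure_distr) auto
  then show ?thesis using K by blast
qed

end

section \<open>Maps that expand every dyadic shell\<close>

definition dyadic_shell :: "'b::real_normed_vector set \<Rightarrow> real \<Rightarrow> nat \<Rightarrow> 'b set" where
  "dyadic_shell Y D j = {z\<in>Y. D / 2 ^ j / 2 < norm z \<and> norm z \<le> D / 2 ^ j}"

text \<open>
  The shift by 4 keeps the threshold below a quarter of the scale \<open>D / 2 ^ j\<close>, so that a
  centre that is close to a point of the shell has norm comparable to the scale.
\<close>

definition shell_threshold :: "real \<Rightarrow> real \<Rightarrow> nat \<Rightarrow> nat \<Rightarrow> real" where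
  "shell_threshold D \<gamma> n j = D / 2 ^ j * (real j + 1) powr (- \<gamma>) / (real n + 4)"

text \<open>
  The index \<open>n\<close> only lowers the threshold by the factor \<open>n + 4\<close>: the union over \<open>n\<close> consists
  of the maps that satisfy the lower bound with some positive constant, and every member of
  the union is closed, so that the union is Borel.
\<close>

definition expanding_maps ::
    "'b::real_normed_vector set \<Rightarrow> real \<Rightarrow> real \<Rightarrow> nat \<Rightarrow> ('b \<Rightarrow>\<^sub>L 'c::real_normed_vector) set" where
  "expanding_maps Y D \<gamma> n =
    {f. \<forall>j. \<forall>z\<in>dyadic_shell Y D j. shell_threshold D \<gamma> n j \<le> norm (blinfun_apply f z)}"

lemma closed_expanding_maps: "closed (expanding_maps Y D \<gamma> n)"
proof -
  have "expanding_maps Y D \<gamma> n =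
      (\<Inter>j. \<Inter>z\<in>dyadic_shell Y D j. {f. shell_threshold D \<gamma> n j \<le> norm (blinfun_apply f z)})"
    by (auto simp: expanding_maps_def)
  also have "closed \<dots>"
    by (intro closed_INT ballI closed_Collect_le continuous_intros blinfun.continuous_on)
  finally show ?thesis .
qed

lemma ex_dyadic_shell:
  assumes z: "z \<in> Y" "z \<noteq> 0" "norm z \<le> D"
  obtains j where "z \<in> dyadic_shell Y D j"
proof -
  have ex: "\<exists>j. D / 2 ^ j / 2 < norm z"
  proof -
    have "D > 0" using z by (metis less_le_trans zero_less_norm_iff)
    obtain j where "(1/2::real) ^ j < norm z / D"
      using real_arch_pow_inv[of "norm z / D" "1/2"] z \<open>D > 0\<close> by auto
    then have "D / 2 ^ j < norm z"
      using \<open>D > 0\<close> by (simp add: power_divide field_simps)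
    moreover have "D / 2 ^ j / 2 \<le> D / 2 ^ j" using \<open>D > 0\<close> by (simp add: field_simps)
    ultimately show ?thesis by (intro exI[of _ j]) linarith
  qed
  define j where "j = (LEAST j. D / 2 ^ j / 2 < norm z)"
  have 1: "D / 2 ^ j / 2 < norm z" unfolding j_def using ex by (rule LeastI_ex)
  have "norm z \<le> D / 2 ^ j"
  proof (cases j)
    case (Suc i)
    then have "i < (LEAST j. D / 2 ^ j / 2 < norm z)" by (simp only: j_def[symmetric])
    then have "\<not> D / 2 ^ i / 2 < norm z" by (rule not_less_Least)
    then show ?thesis using Suc by (simp add: field_simps)
  qed (use z in simp)
  then show thesis using that[of j] 1 z by (simp add: dyadic_shell_def)
qed

lemma expanding_map_lower_bound:
  assumes f: "f \<in> expanding_maps Y D \<gamma> n" and Y: "\<And>z. z \<in> Y \<Longrightarrow> norm z \<le> D"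
    and "D > 0" "\<gamma> \<ge> 0"
  obtains c where "c > 0" "\<And>z. z \<in> Y \<Longrightarrow> z \<noteq> 0 \<Longrightarrow>
    c * (norm z / slog (norm z) powr \<gamma>) \<le> norm (blinfun_apply f z)"
proof -
  define K where "K = (2 + \<bar>ln D\<bar> / ln 2) / ln 2"
  have "K > 0" unfolding K_def by (intro divide_pos_pos add_pos_nonneg) auto
  show thesis
  proof (rule that)
    show "1 / (K powr \<gamma> * (real n + 4)) > 0" using \<open>K > 0\<close> by simp
    fix z assume z: "z \<in> Y" "z \<noteq> 0"
    obtain j where j: "z \<in> dyadic_shell Y D j" using ex_dyadic_shell z Y by metis
    then have nz: "norm z \<le> D / 2 ^ j" by (simp add: dyadic_shell_def)
    have sl: "slog (norm z) > 0" using slog_ge_ln2[of "norm z"] z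
      by (metis less_le_trans ln_gt_zero one_less_numeral_iff semiring_norm(76) zero_less_norm_iff)
    have "real j + 1 \<le> K * slog (norm z)"
      unfolding K_def using z nz \<open>D > 0\<close> by (intro dyadic_index_le_slog) auto
    then have p: "(real j + 1) powr \<gamma> \<le> K powr \<gamma> * slog (norm z) powr \<gamma>"
      using \<open>K > 0\<close> sl \<open>\<gamma> \<ge> 0\<close> by (subst powr_mult[symmetric]) (auto intro: powr_mono2)
    have "1 / (K powr \<gamma> * (real n + 4)) * (norm z / slog (norm z) powr \<gamma>)
        = norm z / (K powr \<gamma> * slog (norm z) powr \<gamma>) / (real n + 4)" by simp
    also have "\<dots> \<le> (D / 2 ^ j) / ((real j + 1) powr \<gamma>) / (real n + 4)"
      using p nz \<open>D > 0\<close> by (intro divide_right_mono frac_le) auto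
    also have "\<dots> = shell_threshold D \<gamma> n j"
      by (simp add: shell_threshold_def powr_minus divide_inverse)
    also have "\<dots> \<le> norm (blinfun_apply f z)" using f j by (auto simp: expanding_maps_def)
    finally show "1 / (K powr \<gamma> * (real n + 4)) * (norm z / slog (norm z) powr \<gamma>)
      \<le> norm (blinfun_apply f z)" .
  qed
qed

section \<open>Prevalence of the expanding maps\<close>

context functional_layers
begin

lemma open_small_value:
  "open {c. \<exists>z\<in>A. norm (blinfun_apply (random_map c - v) z) < (\<rho>::real)}"
proof -
  have "{c. \<exists>z\<in>A. norm (blinfun_apply (random_map c - v) z) < \<rho>} =
      (\<Union>z\<in>A. {c. norm (blinfun_apply (random_map c - v) z) < \<rho>})" by blast
  also have "open \<dots>"
    by (intro open_UN ballI open_Collect_less continuous_intros blinfun.continuous_on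
        continuous_on_random_map)
  finally show ?thesis .
qed

text \<open>
  If \<open>f = random_map c - v\<close> is smaller than \<open>\<rho>\<close> at some point of \<open>A\<close>, then it is smaller than
  \<open>(1 + R) * \<rho>\<close> at a nearby centre, as the norm of \<open>f\<close> is at most \<open>R\<close>. A union bound over the
  centres and the small ball estimate at each of them conclude.
\<close>

lemma small_value_estimate:
  fixes v :: "'b \<Rightarrow>\<^sub>L 'c::euclidean_space"
  assumes C: "finite C" "A \<subseteq> (\<Union>c\<in>C. ball c \<rho>)" and "\<rho> > 0" and "t > 0"
    and norming: "\<And>c z. c \<in> C \<Longrightarrow> z \<in> A \<Longrightarrow> dist c z < \<rho> \<Longrightarrow> \<exists>k<m j. t \<le> \<bar>blinfun_apply (\<phi> j k) c\<bar>"
    and R: "\<And>c. norm (random_map c - v) \<le> R"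
  shows "emeasure coeff_measure {c. \<exists>z\<in>A. norm (blinfun_apply (random_map c - v) z) < \<rho>}
    \<le> ennreal (real (card C) * ((1 + R) * \<rho> * ((real j + 1)\<^sup>2 * real (m j)) / t) ^ DIM('c))"
proof -
  let ?b = "((1 + R) * \<rho> * ((real j + 1)\<^sup>2 * real (m j)) / t) ^ DIM('c)"
  define C' where "C' = {c\<in>C. \<exists>z\<in>A. dist c z < \<rho>}"
  have C': "finite C'" "card C' \<le> card C"
    using C(1) by (auto simp: C'_def intro: card_mono)
  have R0: "R \<ge> 0" using R[of undefined] norm_ge_zero order_trans by blast
  define E where "E x = {c :: nat \<times> nat \<Rightarrow> 'c.
    norm (blinfun_apply (random_map c) x - blinfun_apply v x) < (1 + R) * \<rho>}" for x
  have meas: "E x \<in> sets coeff_measure" for x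
  proof -
    have "open (E x)" unfolding E_def
      by (intro open_Collect_less continuous_intros blinfun.continuous_on continuous_on_random_map)
    then show ?thesis by simp
  qed
  have sub: "{c. \<exists>z\<in>A. norm (blinfun_apply (random_map c - v) z) < \<rho>} \<subseteq> (\<Union>x\<in>C'. E x)"
  proof clarify
    fix c z assume z: "z \<in> A" "norm (blinfun_apply (random_map c - v) z) < \<rho>"
    let ?f = "random_map c - v"
    obtain x where x: "x \<in> C" "dist x z < \<rho>" using C(2) z(1) by auto
    then have "x \<in> C'" using z(1) by (auto simp: C'_def)
    have "norm (blinfun_apply ?f x) \<le> norm (blinfun_apply ?f z) + norm (blinfun_apply ?f (x - z))"
      by (metis blinfun.diff_right norm_triangle_sub)
    also have "norm (blinfun_apply ?f (x - z)) \<le> R * norm (x - z)"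
      using norm_blinfun[of ?f "x - z"] mult_right_mono[OF R[of c], of "norm (x - z)"] by simp
    also have "\<dots> \<le> R * \<rho>" using x(2) R0 by (intro mult_left_mono) (auto simp: dist_norm)
    finally have "norm (blinfun_apply ?f x) < (1 + R) * \<rho>" using z(2) by (simp add: algebra_simps)
    then have "c \<in> E x" by (simp add: E_def blinfun.diff_left)
    then show "c \<in> (\<Union>x\<in>C'. E x)" using \<open>x \<in> C'\<close> by blast
  qed
  have E: "emeasure coeff_measure (E x) \<le> ennreal ?b" if x: "x \<in> C'" for x
  proof -
    obtain k where k: "k < m j" "t \<le> \<bar>blinfun_apply (\<phi> j k) x\<bar>"
      using x norming by (auto simp: C'_def)
    have "emeasure coeff_measure (E x) \<le> ennreal (((1 + R) * \<rho> / (weight j * t)) ^ DIM('c))"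
      unfolding E_def using R0 \<open>\<rho> > 0\<close> \<open>t > 0\<close> k by (intro small_ball_estimate) auto
    also have "(1 + R) * \<rho> / (weight j * t) = (1 + R) * \<rho> * ((real j + 1)\<^sup>2 * real (m j)) / t"
      by (simp add: weight_def)
    finally show ?thesis .
  qed
  have "emeasure coeff_measure {c. \<exists>z\<in>A. norm (blinfun_apply (random_map c - v) z) < \<rho>}
      \<le> emeasure coeff_measure (\<Union>x\<in>C'. E x)"
    using C'(1) meas by (intro emeasure_mono sub) auto
  also have "\<dots> \<le> (\<Sum>x\<in>C'. emeasure coeff_measure (E x))"
    using C'(1) meas by (intro emeasure_subadditive_finite) auto
  also have "\<dots> \<le> (\<Sum>x\<in>C'. ennreal ?b)" by (intro sum_mono E)
  also have "\<dots> = ennreal (real (card C') * ?b)"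
    using R0 \<open>\<rho> > 0\<close> \<open>t > 0\<close> by (simp add: ennreal_mult ennreal_of_nat_eq_real_of_nat)
  also have "\<dots> \<le> ennreal (real (card C) * ?b)"
    using C'(2) R0 \<open>\<rho> > 0\<close> \<open>t > 0\<close> by (intro ennreal_leI mult_right_mono) auto
  finally show ?thesis .
qed

end

text \<open>
  Bookkeeping of exponents. The left-hand side is the number of centres times the small ball
  bound, for \<open>a = j + 1\<close>, the target dimension \<open>N\<close> and a threshold that is \<open>a powr (- \<gamma>) / q\<close>
  times the scale; \<open>l1\<close> and \<open>l2\<close> stand for the two logarithmic factors and \<open>x\<close> for the base of
  the small ball bound. The exponent of \<open>a\<close> on the right is less than \<open>- 1\<close> exactly if
  \<open>\<gamma> * (N - s) > 1 + N * (2 + \<alpha> + \<beta>) + (\<alpha> + \<beta>)\<close>.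
\<close>

lemma shell_series_term_le:
  fixes a q :: real
  assumes "a \<ge> 1" "q \<ge> 1" "\<alpha> \<ge> 0" "\<beta> \<ge> 0" "M \<ge> 0" "K > 0" "K' > 0" "K'' > 0"
    and l1: "0 \<le> l1" "l1 \<le> K * a" and l2: "0 \<le> l2" "l2 \<le> K' * a * (1 + ln q)"
    and x: "0 \<le> x" "x \<le> K'' * a powr (2 + \<alpha> + \<beta> - \<gamma>) / q"
  shows "M * (2 * a powr \<gamma> * q) powr s * l1 powr \<beta> * l2 powr \<alpha> * x ^ N
    \<le> (M * 2 powr s * K powr \<beta> * K' powr \<alpha> * K'' powr real N) *
      a powr (\<alpha> + \<beta> + real N * (2 + \<alpha> + \<beta>) - \<gamma> * (real N - s)) *
      (q powr (s - real N) * (1 + ln q) powr \<alpha>)"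
proof -
  have pos: "a > 0" "q > 0" "1 + ln q > 0" using assms by (auto intro: add_pos_nonneg)
  have "l1 powr \<beta> \<le> (K * a) powr \<beta>" using assms by (intro powr_mono2) auto
  moreover have "l2 powr \<alpha> \<le> (K' * a * (1 + ln q)) powr \<alpha>" using assms by (intro powr_mono2) auto
  moreover have "x ^ N \<le> (K'' * a powr (2 + \<alpha> + \<beta> - \<gamma>) / q) ^ N" using x by (intro power_mono)
  ultimately have "M * (2 * a powr \<gamma> * q) powr s * l1 powr \<beta> * l2 powr \<alpha> * x ^ N
    \<le> M * (2 * a powr \<gamma> * q) powr s * (K * a) powr \<beta> * (K' * a * (1 + ln q)) powr \<alpha> *
      (K'' * a powr (2 + \<alpha> + \<beta> - \<gamma>) / q) ^ N"
    using assms by (intro mult_mono mult_nonneg_nonneg) auto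
  also have "(K'' * a powr (2 + \<alpha> + \<beta> - \<gamma>) / q) ^ N = (K'' * a powr (2 + \<alpha> + \<beta> - \<gamma>) / q) powr real N"
    using pos \<open>K'' > 0\<close> by (subst powr_realpow) auto
  also have "M * (2 * a powr \<gamma> * q) powr s * (K * a) powr \<beta> * (K' * a * (1 + ln q)) powr \<alpha> *
      (K'' * a powr (2 + \<alpha> + \<beta> - \<gamma>) / q) powr real N
    = (M * 2 powr s * K powr \<beta> * K' powr \<alpha> * K'' powr real N) *
      (a powr (\<gamma> * s) * a powr \<beta> * a powr \<alpha> * a powr ((2 + \<alpha> + \<beta> - \<gamma>) * real N)) *
      (q powr s / q powr real N * (1 + ln q) powr \<alpha>)"
    using pos assms by (simp add: powr_mult powr_divide powr_powr)
  also have "a powr (\<gamma> * s) * a powr \<beta> * a powr \<alpha> * a powr ((2 + \<alpha> + \<beta> - \<gamma>) * real N)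
     = a powr (\<alpha> + \<beta> + real N * (2 + \<alpha> + \<beta>) - \<gamma> * (real N - s))"
    by (simp add: powr_add[symmetric] algebra_simps)
  also have "q powr s / q powr real N = q powr (s - real N)" by (simp add: powr_diff)
  finally show ?thesis .
qed

text \<open>
  The probability that the lower bound with index \<open>n\<close> fails is at most the sum over the scales
  \<open>j\<close> of the failure probabilities on the shells. By the hypothesis on the exponent the sum
  converges, and \<open>n\<close> enters through a common factor that tends to 0 when \<open>s\<close> is less than the
  target dimension. Treating all shells at once with a constant that worsens with \<open>n\<close> covers
  the finitely many coarse scales as well, which a Borel-Cantelli argument would leave to be
  dealt with separately.
\<close>

lemma (in functional_layers) not_expanding_estimate:
  fixes Y :: "'b set" and v :: "'b \<Rightarrow>\<^sub>L 'c::euclidean_space"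
  assumes "\<alpha> \<ge> 0" "\<beta> \<ge> 0" "M > 0" "\<gamma> \<ge> 0" and hom: "almost_homogeneous_with \<alpha> \<beta> M s Y"
    and "D > 0" and Y0: "Y = {} \<or> 0 \<in> Y"
    and "K > 0" and m: "\<And>j. real (m j) \<le> K * (real j + 1) powr (\<alpha> + \<beta>)"
    and norming: "\<And>j z. z \<in> Y \<Longrightarrow> D / 2 ^ j / 4 \<le> norm z \<Longrightarrow> norm z < 2 * (D / 2 ^ j) \<Longrightarrow>
      \<exists>k<m j. D / 2 ^ j / 8 \<le> blinfun_apply (\<phi> j k) z"
    and exponent: "\<alpha> + \<beta> + real DIM('c) * (2 + \<alpha> + \<beta>) - \<gamma> * (real DIM('c) - s) < - 1"
  obtains L where "\<And>n. emeasure coeff_measure {c. random_map c - v \<notin> expanding_maps Y D \<gamma> n}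
    \<le> ennreal (L * ((real n + 4) powr (s - real DIM('c)) * (1 + ln (real n + 4)) powr \<alpha>))"
proof -
  define N where "N = DIM('c)"
  define R where "R = (\<Sum>j. 1 / (real j + 1)\<^sup>2) + norm v"
  have R: "norm (random_map c - v) \<le> R" for c
    using norm_triangle_ineq4[of "random_map c" v] norm_random_map_le[of c] unfolding R_def by linarith
  have "R \<ge> 0" using R[of undefined] norm_ge_zero order_trans by blast
  define K1 where "K1 = 2 + \<bar>ln (2 * D)\<bar>"
  define K2 where "K2 = 2 + \<bar>ln D\<bar> + \<gamma>"
  define K3 where "K3 = 8 * (1 + R) * K"
  have pos: "K1 > 0" "K2 > 0" "K3 > 0"
    using \<open>K > 0\<close> \<open>R \<ge> 0\<close> \<open>\<gamma> \<ge> 0\<close> by (auto simp: K1_def K2_def K3_def add_pos_nonneg)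
  define P where "P = M * 2 powr s * K1 powr \<beta> * K2 powr \<alpha> * K3 powr real N"
  define e where "e = \<alpha> + \<beta> + real N * (2 + \<alpha> + \<beta>) - \<gamma> * (real N - s)"
  define g where "g n = (real n + 4) powr (s - real N) * (1 + ln (real n + 4)) powr \<alpha>" for n :: nat
  define E where "E n j = {c. \<exists>z\<in>dyadic_shell Y D j.
    norm (blinfun_apply (random_map c - v) z) < shell_threshold D \<gamma> n j}" for n j
  have g0: "g n \<ge> 0" for n by (simp add: g_def)
  have P0: "P \<ge> 0" using \<open>M > 0\<close> by (simp add: P_def)
  have E: "emeasure coeff_measure (E n j) \<le> ennreal (P * (real j + 1) powr e * g n)" for n j
  proof -
    define a where "a = real j + 1"
    define q where "q = real n + 4"
    define d where "d = D / 2 ^ j"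
    define \<rho> where "\<rho> = shell_threshold D \<gamma> n j"
    have a: "a \<ge> 1" and q: "q \<ge> 4" and d: "d > 0" using \<open>D > 0\<close> by (auto simp: a_def q_def d_def)
    have \<rho>: "\<rho> = d * a powr (- \<gamma>) / q" by (simp add: \<rho>_def shell_threshold_def a_def q_def d_def)
    have "\<rho> > 0" using a q d by (simp add: \<rho>)
    \<comment> \<open>The bound \<open>\<rho> \<le> d / 4\<close> keeps the centres of balls that meet the shell in the range of norms
      where the functionals of this scale are effective.\<close>
    have "a powr (- \<gamma>) \<le> 1" using powr_mono[of "- \<gamma>" 0 a] a \<open>\<gamma> \<ge> 0\<close> by simp
    then have "\<rho> \<le> d / 4" unfolding \<rho> using d q a by (intro frac_le mult_left_le) auto
    then have "\<rho> < 2 * d" using d by linarith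
    obtain C where C: "finite C" "C \<subseteq> Y" "Y \<inter> ball 0 (2 * d) \<subseteq> (\<Union>c\<in>C. ball c \<rho>)"
      and card: "real (card C) \<le> M * (2 * d / \<rho>) powr s * slog (2 * d) powr \<beta> * slog \<rho> powr \<alpha>"
      by (rule almost_homogeneous_cover_0[OF hom Y0 less_imp_le[OF \<open>M > 0\<close>] \<open>\<rho> > 0\<close> \<open>\<rho> < 2 * d\<close>])
        (rule that)
    define x where "x = (1 + R) * \<rho> * (a\<^sup>2 * real (m j)) / (d / 8)"
    have "emeasure coeff_measure (E n j) \<le> ennreal (real (card C) * x ^ N)"
      unfolding E_def N_def x_def a_def \<rho>_def[symmetric]
    proof (rule small_value_estimate[OF C(1) _ \<open>\<rho> > 0\<close> _ _ R])
      show "dyadic_shell Y D j \<subseteq> (\<Union>c\<in>C. ball c \<rho>)"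
        using C(3) d by (auto simp: dyadic_shell_def d_def)
      show "d / 8 > 0" using d by simp
      fix c z assume c: "c \<in> C" and z: "z \<in> dyadic_shell Y D j" and cz: "dist c z < \<rho>"
      have "d / 2 < norm z" "norm z \<le> d" using z by (auto simp: dyadic_shell_def d_def)
      moreover have "\<bar>norm c - norm z\<bar> < \<rho>"
        using cz norm_triangle_ineq3[of c z] by (simp add: dist_norm)
      ultimately have "d / 4 \<le> norm c" "norm c < 2 * d"
        using \<open>\<rho> \<le> d / 4\<close> d by linarith+
      then obtain k where "k < m j" "d / 8 \<le> blinfun_apply (\<phi> j k) c"
        using norming[of c j] c C(2) unfolding d_def by blast
      then show "\<exists>k<m j. d / 8 \<le> \<bar>blinfun_apply (\<phi> j k) c\<bar>" by (intro exI[of _ k]) auto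
    qed
    also have "real (card C) * x ^ N
        \<le> (M * (2 * d / \<rho>) powr s * slog (2 * d) powr \<beta> * slog \<rho> powr \<alpha>) * x ^ N"
      using card \<open>\<rho> > 0\<close> d \<open>R \<ge> 0\<close> by (intro mult_right_mono) (auto simp: x_def)
    also have "2 * d / \<rho> = 2 * a powr \<gamma> * q"
      using a q d by (simp add: \<rho> powr_minus field_simps)
    also have "M * (2 * a powr \<gamma> * q) powr s * slog (2 * d) powr \<beta> * slog \<rho> powr \<alpha> * x ^ N
        \<le> (M * 2 powr s * K1 powr \<beta> * K2 powr \<alpha> * K3 powr real N) *
      a powr (\<alpha> + \<beta> + real N * (2 + \<alpha> + \<beta>) - \<gamma> * (real N - s)) *
      (q powr (s - real N) * (1 + ln q) powr \<alpha>)"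
    proof (rule shell_series_term_le)
      show "slog (2 * d) \<le> K1 * a"
        using slog_dyadic_le[of "2 * D" 0 1 j] \<open>D > 0\<close> by (simp add: d_def K1_def a_def)
      show "slog \<rho> \<le> K2 * a * (1 + ln q)"
        using slog_dyadic_le[of D \<gamma> q j] \<open>D > 0\<close> q \<open>\<gamma> \<ge> 0\<close>
        by (simp add: \<rho> d_def K2_def a_def)
      show "0 \<le> slog (2 * d)" "0 \<le> slog \<rho>"
        using slog_ge_abs_ln[of "2 * d"] slog_ge_abs_ln[of \<rho>] d \<open>\<rho> > 0\<close> by auto
      show "0 \<le> x" using \<open>\<rho> > 0\<close> d \<open>R \<ge> 0\<close> by (simp add: x_def)
      have "x = 8 * (1 + R) * (a powr (- \<gamma>) * a powr 2 * real (m j)) / q"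
        using d a q by (simp add: x_def \<rho>)
      also have "\<dots> \<le> 8 * (1 + R) * (a powr (- \<gamma>) * a powr 2 * (K * a powr (\<alpha> + \<beta>))) / q"
        using q \<open>R \<ge> 0\<close> m[of j] by (intro divide_right_mono mult_left_mono) (auto simp: a_def)
      also have "a powr (- \<gamma>) * a powr 2 * (K * a powr (\<alpha> + \<beta>))
          = K * (a powr (- \<gamma>) * a powr 2 * a powr (\<alpha> + \<beta>))" by (simp only: mult_ac)
      also have "a powr (- \<gamma>) * a powr 2 * a powr (\<alpha> + \<beta>) = a powr (2 + \<alpha> + \<beta> - \<gamma>)"
        by (simp add: powr_add[symmetric] algebra_simps del: powr_numeral)
      finally show "x \<le> K3 * a powr (2 + \<alpha> + \<beta> - \<gamma>) / q" by (simp add: K3_def)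
    qed (use a q assms pos in auto)
    also have "\<dots> = P * (real j + 1) powr e * g n"
      by (simp add: P_def a_def e_def g_def q_def)
    finally show ?thesis by (auto intro: ennreal_leI)
  qed
  have sum: "summable (\<lambda>j. (real j + 1) powr e)"
  proof -
    have "summable (\<lambda>j. real (Suc j) powr e)"
      using exponent by (subst summable_Suc_iff) (simp add: summable_real_powr_iff e_def N_def)
    then show ?thesis by (simp add: add.commute)
  qed
  show thesis
  proof (rule that)
    fix n
    have "open (E n j)" for j unfolding E_def by (rule open_small_value)
    then have meas: "range (E n) \<subseteq> sets coeff_measure" by auto
    have "{c. random_map c - v \<notin> expanding_maps Y D \<gamma> n} = (\<Union>j. E n j)"
      by (auto simp: expanding_maps_def E_def not_le)
    then have "emeasure coeff_measure {c. random_map c - v \<notin> expanding_maps Y D \<gamma> n}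
        \<le> (\<Sum>j. emeasure coeff_measure (E n j))"
      using emeasure_subadditive_countably[OF meas] by simp
    also have "\<dots> \<le> (\<Sum>j. ennreal (P * g n * (real j + 1) powr e))"
      using E[of n] by (intro suminf_le) (auto simp: mult_ac)
    also have "\<dots> = ennreal (\<Sum>j. P * g n * (real j + 1) powr e)"
      using P0 g0 sum by (intro suminf_ennreal2 summable_mult) auto
    also have "(\<Sum>j. P * g n * (real j + 1) powr e) = P * (\<Sum>j. (real j + 1) powr e) * g n"
      using suminf_mult[OF sum, of "P * g n"] by (simp add: mult_ac)
    finally show "emeasure coeff_measure {c. random_map c - v \<notin> expanding_maps Y D \<gamma> n}
        \<le> ennreal (P * (\<Sum>j. (real j + 1) powr e) *
          ((real n + 4) powr (s - real DIM('c)) * (1 + ln (real n + 4)) powr \<alpha>))"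
      by (simp add: g_def N_def)
  qed
qed

lemma image_add_eq_vimage_diff: "(\<lambda>f. f + v) ` A = (\<lambda>f. f - v) -` (A :: 'a::group_add set)"
proof (intro equalityI subsetI)
  fix f assume "f \<in> (\<lambda>f. f - v) -` A"
  then show "f \<in> (\<lambda>f. f + v) ` A" by (intro image_eqI[of _ _ "f - v"]) auto
qed auto

text \<open>
  The translate by \<open>v\<close> has full measure under the probe if almost every \<open>random_map c - v\<close>
  lies in some \<open>expanding_maps Y D \<gamma> n\<close>. The event that it lies in none has probability at
  most the failure probability for each \<open>n\<close>, and these tend to 0.
\<close>

lemma prevalent_expanding_maps:
  fixes Y :: "'b::real_normed_vector set"
  assumes "\<alpha> \<ge> 0" "\<beta> \<ge> 0" "M > 0" "\<gamma> \<ge> 0" and hom: "almost_homogeneous_with \<alpha> \<beta> M s Y"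
    and "D > 0" and Y0: "Y = {} \<or> 0 \<in> Y" and s: "s < real DIM('c)"
    and exponent: "\<alpha> + \<beta> + real DIM('c) * (2 + \<alpha> + \<beta>) - \<gamma> * (real DIM('c) - s) < - 1"
  shows "prevalent (\<Union>n. expanding_maps Y D \<gamma> n :: ('b \<Rightarrow>\<^sub>L 'c::euclidean_space) set)"
proof -
  let ?S = "\<Union>n. expanding_maps Y D \<gamma> n :: ('b \<Rightarrow>\<^sub>L 'c) set"
  obtain K and m :: "nat \<Rightarrow> nat" and \<phi> :: "nat \<Rightarrow> nat \<Rightarrow> 'b \<Rightarrow>\<^sub>L real" where "K > 0"
    and m: "\<And>j. real (m j) \<le> K * (real j + 1) powr (\<alpha> + \<beta>)"
    and \<phi>: "\<And>j k. norm (\<phi> j k) \<le> 1"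
    and norming: "\<And>j z. z \<in> Y \<Longrightarrow> D / 2 ^ j / 4 \<le> norm z \<Longrightarrow> norm z < 2 * (D / 2 ^ j) \<Longrightarrow>
      \<exists>k<m j. D / 2 ^ j / 8 \<le> blinfun_apply (\<phi> j k) z"
    using ex_shell_norming_functionals[OF assms(1-3) hom \<open>D > 0\<close> Y0] by blast
  interpret functional_layers m \<phi> by unfold_locales (rule \<phi>)
  interpret P: prob_space "coeff_measure :: (nat \<times> nat \<Rightarrow> 'c) measure"
    by (rule prob_space_coeff_measure)
  have S: "?S \<in> sets borel"
    by (intro sets.countable_UN) (auto intro: borel_closed closed_expanding_maps)
  have full: "emeasure probe_measure ((\<lambda>f. f + v) ` ?S) = 1" for v
  proof -
    let ?T = "\<lambda>n. {c. random_map c - v \<notin> expanding_maps Y D \<gamma> n}"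
    have "(\<lambda>f. f - v) -` ?S \<inter> space borel \<in> sets borel"
      by (intro measurable_sets[OF _ S] borel_measurable_continuous_onI continuous_intros)
    moreover have "(\<lambda>f. f + v) ` ?S = (\<lambda>f. f - v) -` ?S" by (rule image_add_eq_vimage_diff)
    ultimately have trans: "(\<lambda>f. f + v) ` ?S \<in> sets borel" "(\<lambda>f. f + v) ` ?S = (\<lambda>f. f - v) -` ?S"
      by auto
    define G where "G = random_map -` ((\<lambda>f. f + v) ` ?S)"
    have G: "G \<in> P.events"
      using measurable_sets[OF random_map_measurable trans(1)] by (simp add: G_def)
    obtain L where L: "\<And>n. emeasure coeff_measure (?T n)
        \<le> ennreal (L * ((real n + 4) powr (s - real DIM('c)) * (1 + ln (real n + 4)) powr \<alpha>))"
      using not_expanding_estimate[OF assms(1-4) hom \<open>D > 0\<close> Y0 \<open>K > 0\<close> m norming exponent, of v]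
      by blast
    have "(\<lambda>n. L * ((real n + 4) powr (s - real DIM('c)) * (1 + ln (real n + 4)) powr \<alpha>)) \<longlonglongrightarrow> L * 0"
      using s \<open>\<alpha> \<ge> 0\<close> by (intro tendsto_mult_left) real_asymp
    then have lim: "(\<lambda>n. ennreal (L * ((real n + 4) powr (s - real DIM('c)) * (1 + ln (real n + 4)) powr \<alpha>)))
        \<longlonglongrightarrow> 0"
      using tendsto_ennrealI by fastforce
    have "emeasure coeff_measure (- G) \<le> emeasure coeff_measure (?T n)" for n
    proof (rule emeasure_mono)
      show "- G \<subseteq> ?T n" unfolding G_def trans(2) by auto
      have "open ((\<lambda>c. random_map c - v) -` (- expanding_maps Y D \<gamma> n) :: (nat \<times> nat \<Rightarrow> 'c) set)"
        by (intro open_vimage open_Compl closed_expanding_maps continuous_intros continuous_on_random_map)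
      then show "?T n \<in> P.events" by (simp add: vimage_def)
    qed
    then have "emeasure coeff_measure (- G) \<le> 0"
      using L order_trans by (intro LIMSEQ_le_const[OF lim]) blast
    then have "P.prob (- G) = 0" by (simp add: measure_def)
    then have "P.prob G = 1" using P.prob_compl[OF G] by (simp add: Compl_eq_Diff_UNIV)
    then have "emeasure coeff_measure G = 1" by (simp add: P.emeasure_eq_measure)
    then show ?thesis
      unfolding probe_measure_def G_def using trans(1) by (subst emeasure_distr) auto
  qed
  show ?thesis
    unfolding prevalent_def
    using S prob_space_probe_measure probe_measure_compact full
    by (intro conjI exI[of _ probe_measure]) (auto simp: probe_measure_def)
qed

section \<open>Almost bi-Lipschitz embeddings\<close>

text \<open>
  By linearity everything reduces to lower bounds on \<open>X - X\<close>: the upper Lipschitz bound is the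
  boundedness of \<open>f\<close>, and positivity of the lower bound gives injectivity.
\<close>

lemma almost_bi_lipschitz_onI:
  fixes f :: "'b::real_normed_vector \<Rightarrow>\<^sub>L 'c::real_normed_vector"
  assumes "c > 0"
    and lower: "\<And>z. z \<in> difference_set X \<Longrightarrow> z \<noteq> 0 \<Longrightarrow>
      c * (norm z / slog (norm z) powr \<gamma>) \<le> norm (blinfun_apply f z)"
  shows "inj_on (blinfun_apply f) X \<and> almost_bi_lipschitz_on \<gamma> X (blinfun_apply f)"
proof -
  have diff: "c * (norm (x - y) / slog (norm (x - y)) powr \<gamma>) \<le> norm (blinfun_apply f x - blinfun_apply f y)"
    if "x \<in> X" "y \<in> X" "x \<noteq> y" for x y
    using lower[of "x - y"] that by (auto simp: difference_set_def blinfun.diff_right)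
  have "blinfun_apply f x \<noteq> blinfun_apply f y" if xy: "x \<in> X" "y \<in> X" "x \<noteq> y" for x y
  proof -
    have "slog (norm (x - y)) > 0" using slog_ge_ln2[of "norm (x - y)"] xy
      by (smt (verit) ln_gt_zero zero_less_norm_iff right_minus_eq)
    then have "c * (norm (x - y) / slog (norm (x - y)) powr \<gamma>) > 0"
      using \<open>c > 0\<close> xy by simp
    then show ?thesis using diff[OF xy] by auto
  qed
  then have inj: "inj_on (blinfun_apply f) X" by (auto simp: inj_on_def)
  define L where "L = max (1 / c) (norm f)"
  have "1 / c \<le> L" "norm f \<le> L" by (simp_all add: L_def)
  moreover from this have "L > 0" using \<open>c > 0\<close> by (metis less_le_trans zero_less_divide_1_iff)
  ultimately have L: "L > 0" "1 / L \<le> c" "norm f \<le> L"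
    using \<open>c > 0\<close> by (simp_all add: field_simps)
  have "1 / L * (norm (x - y) / slog (norm (x - y)) powr \<gamma>) \<le> norm (blinfun_apply f x - blinfun_apply f y)"
    if "x \<in> X" "y \<in> X" "x \<noteq> y" for x y
    using mult_right_mono[OF L(2), of "norm (x - y) / slog (norm (x - y)) powr \<gamma>"] diff[OF that]
    by (simp del: times_divide_eq_right)
  moreover have "norm (blinfun_apply f x - blinfun_apply f y) \<le> L * norm (x - y)" for x y
    using norm_blinfun[of f "x - y"] mult_right_mono[OF L(3), of "norm (x - y)"]
    by (simp add: blinfun.diff_right)
  ultimately show ?thesis
    using inj L(1) unfolding almost_bi_lipschitz_on_def by blast
qed

theorem theorem7p2:
  fixes X :: "'b::banach set"
    and \<alpha> \<beta> \<gamma> s :: real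
  assumes "\<alpha> \<ge> 0" and "\<beta> \<ge> 0"
    and "compact X"
    and "almost_homogeneous \<alpha> \<beta> (difference_set X)"
    and "assouad_dim \<alpha> \<beta> (difference_set X) < ereal s"
    and "s < real CARD('n::finite)"
    and "\<gamma> > (1 + real CARD('n) * (2 + \<alpha> + \<beta>) + (\<alpha> + \<beta>)) / (real CARD('n) - s)"
  shows "\<exists>S :: ('b \<Rightarrow>\<^sub>L (real ^ 'n)) set. prevalent S \<and>
    (\<forall>f\<in>S. inj_on (blinfun_apply f) X \<and> almost_bi_lipschitz_on \<gamma> X (blinfun_apply f))"
proof -
  let ?Y = "difference_set X"
  obtain M where M: "M \<ge> 1" and hom: "almost_homogeneous_with \<alpha> \<beta> M s ?Y"
    using almost_homogeneous_if_assouad_dim_less[OF assms(5)] by metis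
  have "(1 + real CARD('n) * (2 + \<alpha> + \<beta>) + (\<alpha> + \<beta>)) / (real CARD('n) - s) \<ge> 0"
    using assms by (intro divide_nonneg_nonneg add_nonneg_nonneg mult_nonneg_nonneg) auto
  then have "\<gamma> \<ge> 0" using assms(7) by linarith
  have exponent: "\<alpha> + \<beta> + real DIM(real ^ 'n) * (2 + \<alpha> + \<beta>) - \<gamma> * (real DIM(real ^ 'n) - s) < - 1"
    using assms(6,7) by (simp add: pos_divide_less_eq)
  obtain b where b: "b > 0" "\<And>x. x \<in> X \<Longrightarrow> norm x \<le> b"
    using compact_imp_bounded[OF assms(3)] by (auto simp: bounded_pos)
  have Y: "norm z \<le> 2 * b" if "z \<in> ?Y" for z
  proof -
    obtain x y where xy: "x \<in> X" "y \<in> X" "z = x - y" using \<open>z \<in> ?Y\<close> by (auto simp: difference_set_def)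
    then show ?thesis using norm_triangle_ineq4[of x y] b(2)[of x] b(2)[of y] by simp
  qed
  have Y0: "?Y = {} \<or> 0 \<in> ?Y" by (force simp: difference_set_def)
  let ?S = "\<Union>n. expanding_maps ?Y (2 * b) \<gamma> n :: ('b \<Rightarrow>\<^sub>L (real ^ 'n)) set"
  have "prevalent ?S"
    using M b(1) assms(6) by (intro prevalent_expanding_maps[OF assms(1,2) _ \<open>\<gamma> \<ge> 0\<close> hom _ Y0 _ exponent]) auto
  moreover have "inj_on (blinfun_apply f) X \<and> almost_bi_lipschitz_on \<gamma> X (blinfun_apply f)"
    if "f \<in> ?S" for f
  proof -
    obtain n where n: "f \<in> expanding_maps ?Y (2 * b) \<gamma> n" using \<open>f \<in> ?S\<close> by blast
    have "2 * b > 0" using b(1) by simp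
    then obtain c where "c > 0" "\<And>z. z \<in> ?Y \<Longrightarrow> z \<noteq> 0 \<Longrightarrow>
        c * (norm z / slog (norm z) powr \<gamma>) \<le> norm (blinfun_apply f z)"
      using expanding_map_lower_bound[OF n Y _ \<open>\<gamma> \<ge> 0\<close>] by blast
    then show ?thesis by (rule almost_bi_lipschitz_onI)
  qed
  ultimately show ?thesis by blast
qed

end
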